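(* Let $s$ and $d$ be integers satisfying $1\le s\le d$, and let $\sigma>0$. The minimax rate of testing on $\Theta_s$ is equal to $\lambda=\sigma\sqrt{\log(1+d/s^2)}$ for $s\le\sqrt d$. Furthermore, the minimax rate of testing on $\Theta_s^*$ is equal to $$\lambda=\begin{cases}\sigma\sqrt{\log(1+d/s^2)}&\text{if } s<\sqrt d,\\ \sigma d^{1/4}/\sqrt s&\text{if } s\ge\sqrt d.\end{cases}$$
   Context: Model: one observes $y_j=\theta_j+\sigma\xi_j$, $j=1,\dots,d$, where $\theta\in\mathbb R^d$ is unknown, $\xi_1,\dots,\xi_d$ are i.i.d. standard normal and $\sigma>0$; $\mathbf P_\theta$ is the law of $(y_1,\dots,y_d)$. $\|\theta\|_0$ is the number of non-zero components of $\theta$. For an integer $s\in[1,d]$ and $\delta>0$, $$\Theta_s(\delta)=\{\theta\in\mathbb R^d:\|\theta\|_0=s,\ \theta_j\in\{0,\delta\},\ j=1,\dots,d\},$$ $$\Theta_s^*(\delta)=\Big\{\theta\in\mathbb R^d:\|\theta\|_0=s,\ \min_{j:\theta_j\ne0}|\theta_j|\ge\delta\Big\}.$$ For a family of sets $\Theta(\delta)$, $\delta>0$ (here $\Theta_s(\cdot)$ or $\Theta_s^*(\cdot)$), the minimax risk of testing $\mathbf H_0:\theta=0$ against $\mathbf H_1:\theta\in\Theta(\delta)$ is $$\mathcal R(\delta)=\inf_\Delta\Big\{\mathbf P_0(\Delta=1)+\sup_{\theta\in\Theta(\delta)}\mathbf P_\theta(\Delta=0)\Big\},$$ where $\inf_\Delta$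 is over all $\{0,1\}$-valued statistics (measurable functions of $(y_1,\dots,y_d)$). The minimax rate of testing on this family is defined as $\lambda>0$ for which: (i) for any $\varepsilon\in(0,1)$ there exists $A_\varepsilon>0$ such that $\mathcal R(A\lambda)\le\varepsilon$ for all $A>A_\varepsilon$; (ii) for any $\varepsilon\in(0,1)$ there exists $a_\varepsilon>0$ such that $\mathcal R(A\lambda)\ge1-\varepsilon$ for all $0<A<a_\varepsilon$. Here the definition is non-asymptotic and uniform: $A_\varepsilon,a_\varepsilon$ depend only on $\varepsilon$, not on $s,d,\sigma$. *)

theory Defs
  imports "HOL-Probability.Probability"
begin

text \<open>
  The rate of testing has to be uniform in the dimension \<open>d\<close>, so \<open>\<real>\<^sup>d\<close> cannot be a type here: it is
  the set \<open>{1..d} \<rightarrow>\<^sub>E UNIV\<close> of extensional functions, which is the space of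
  \<open>\<Pi>\<^sub>M j\<in>{1..d}. borel\<close>.
\<close>

abbreviation borel_vec :: "nat \<Rightarrow> (nat \<Rightarrow> real) measure" where
  "borel_vec d \<equiv> \<Pi>\<^sub>M j\<in>{1..d}. borel"

definition zero_vec :: "nat \<Rightarrow> nat \<Rightarrow> real" where
  "zero_vec d = (\<lambda>j\<in>{1..d}. 0)"

definition noise_law :: "nat \<Rightarrow> (nat \<Rightarrow> real) measure" where
  "noise_law d = (\<Pi>\<^sub>M j\<in>{1..d}. std_normal_distribution)"

definition obs_law :: "nat \<Rightarrow> real \<Rightarrow> (nat \<Rightarrow> real) \<Rightarrow> (nat \<Rightarrow> real) measure" where
  "obs_law d \<sigma> \<theta> =
     distr (noise_law d) (borel_vec d) (\<lambda>\<xi>. \<lambda>j\<in>{1..d}. \<theta> j + \<sigma> * \<xi> j)"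

definition l0_norm :: "nat \<Rightarrow> (nat \<Rightarrow> real) \<Rightarrow> nat" where
  "l0_norm d \<theta> = card {j \<in> {1..d}. \<theta> j \<noteq> 0}"

definition Theta :: "nat \<Rightarrow> nat \<Rightarrow> real \<Rightarrow> (nat \<Rightarrow> real) set" where
  "Theta d s \<delta> =
     {\<theta> \<in> {1..d} \<rightarrow>\<^sub>E UNIV. l0_norm d \<theta> = s \<and> (\<forall>j\<in>{1..d}. \<theta> j \<in> {0, \<delta>})}"

text \<open>For \<open>s \<ge> 1\<close> the minimum below is over a nonempty finite set.\<close>

definition Theta_star :: "nat \<Rightarrow> nat \<Rightarrow> real \<Rightarrow> (nat \<Rightarrow> real) set" where
  "Theta_star d s \<delta> =
     {\<theta> \<in> {1..d} \<rightarrow>\<^sub>E UNIV. l0_norm d \<theta> = s \<and>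
        Min ((\<lambda>j. \<bar>\<theta> j\<bar>) ` {j \<in> {1..d}. \<theta> j \<noteq> 0}) \<ge> \<delta>}"

definition tests :: "nat \<Rightarrow> ((nat \<Rightarrow> real) \<Rightarrow> nat) set" where
  "tests d = borel_vec d \<rightarrow>\<^sub>M count_space {0, 1}"

text \<open>
  The supremum and infimum are taken in \<open>\<real>\<close>. All quantities lie in \<open>[0, 2]\<close>, so they have their
  usual meaning as soon as \<open>T\<close> is nonempty; \<open>Theta d s \<delta>\<close> and \<open>Theta_star d s \<delta>\<close> are nonempty
  for \<open>1 \<le> s \<le> d\<close> and \<open>\<delta> > 0\<close>.
\<close>

definition minimax_risk :: "nat \<Rightarrow> real \<Rightarrow> (nat \<Rightarrow> real) set \<Rightarrow> real" where
  "minimax_risk d \<sigma> T =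
     (INF \<Delta>\<in>tests d.
        measure (obs_law d \<sigma> (zero_vec d)) {y \<in> space (borel_vec d). \<Delta> y = 1} +
        (SUP \<theta>\<in>T. measure (obs_law d \<sigma> \<theta>) {y \<in> space (borel_vec d). \<Delta> y = 0}))"

text \<open>
  \<open>F d s \<delta>\<close> is the alternative in dimension \<open>d\<close> with sparsity \<open>s\<close> and separation \<open>\<delta>\<close>; the rate
  \<open>lam\<close> is a function of \<open>(d, s, \<sigma>)\<close>, which ranges over \<open>I\<close>. The constants are chosen before
  \<open>(d, s, \<sigma>)\<close>, that is, they depend on \<open>\<epsilon>\<close> only.
\<close>

definition minimax_testing_rate ::
  "(nat \<times> nat \<times> real) set \<Rightarrow> (nat \<Rightarrow> nat \<Rightarrow> real \<Rightarrow> (nat \<Rightarrow> real) set) \<Rightarrow>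
   (nat \<Rightarrow> nat \<Rightarrow> real \<Rightarrow> real) \<Rightarrow> bool" where
  "minimax_testing_rate I F lam \<longleftrightarrow>
     (\<forall>(d, s, \<sigma>)\<in>I. lam d s \<sigma> > 0) \<and>
     (\<forall>\<epsilon>. 0 < \<epsilon> \<and> \<epsilon> < 1 \<longrightarrow>
        (\<exists>A\<^sub>0>0. \<forall>(d, s, \<sigma>)\<in>I. \<forall>A>A\<^sub>0.
           minimax_risk d \<sigma> (F d s (A * lam d s \<sigma>)) \<le> \<epsilon>)) \<and>
     (\<forall>\<epsilon>. 0 < \<epsilon> \<and> \<epsilon> < 1 \<longrightarrow>
        (\<exists>a\<^sub>0>0. \<forall>(d, s, \<sigma>)\<in>I. \<forall>A. 0 < A \<and> A < a\<^sub>0 \<longrightarrow>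
           minimax_risk d \<sigma> (F d s (A * lam d s \<sigma>)) \<ge> 1 - \<epsilon>))"

end

theory Submission
  imports Defs
begin

text \<open>
  Lower bounds: a prior with one spike of height \<open>\<delta>\<close> in each of \<open>s\<close> blocks of length about \<open>d / s\<close> has
  a likelihood ratio whose second moment is at most \<open>exp (2 * s\<^sup>2 * \<kappa> / d)\<close>, where \<open>\<kappa>\<close> is
  \<open>exp (\<delta>\<^sup>2 / \<sigma>\<^sup>2) - 1\<close> for spikes of constant sign and \<open>cosh (\<delta>\<^sup>2 / \<sigma>\<^sup>2) - 1\<close> for spikes of random sign.
  At a small multiple of the rate this is close to \<open>1\<close>: the constant sign suffices in the sparse zone,
  the random sign is needed in the dense zone.

  Upper bounds: Chebyshev's inequality for the statistic \<open>\<Sum>j. \<phi> (y j)\<close>. In the dense zone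
  \<open>\<phi> y = y\<^sup>2\<close>. In the sparse zone \<open>\<phi>\<close> is the indicator of \<open>\<bar>y\<bar> > \<sigma> * t\<close> with
  \<open>t\<^sup>2 = 2 * K * ln (1 + d / s\<^sup>2)\<close>; if \<open>\<delta> \<ge> 2 * \<sigma> * t\<close>, then each coordinate contributes a variance of
  at most \<open>2 * exp (- t\<^sup>2 / 2)\<close> under both hypotheses, so that the standard deviation of the statistic is
  small compared with \<open>s\<close>, the order of the shift of its mean.
\<close>

section \<open>The observation law as a product of Gaussian measures\<close>

abbreviation gauss :: "real \<Rightarrow> real \<Rightarrow> real measure" where
  "gauss \<mu> \<sigma> \<equiv> density lborel (\<lambda>x. ennreal (normal_density \<mu> \<sigma> x))"

lemma product_prob_space_gauss: "0 < \<sigma> \<Longrightarrow> product_prob_space (\<lambda>j. gauss (\<theta> j) \<sigma>)"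
  by (intro product_prob_spaceI prob_space_normal_density)

lemma distr_gauss_affine:
  assumes "0 < \<sigma>"
  shows "distr std_normal_distribution borel (\<lambda>x. \<mu> + \<sigma> * x) = gauss \<mu> \<sigma>"
proof -
  interpret prob_space std_normal_distribution
    by (rule prob_space_normal_density) simp
  have "distributed std_normal_distribution lborel (\<lambda>x. x) std_normal_density"
    by (simp add: distributed_def distr_id2)
  then have "distributed std_normal_distribution lborel (\<lambda>x. \<mu> + \<sigma> * x) (normal_density \<mu> \<sigma>)"
    using normal_density_affine[of "\<lambda>x. x" 0 1 \<sigma> \<mu>] assms by simp
  then have "distr std_normal_distribution lborel (\<lambda>x. \<mu> + \<sigma> * x) = gauss \<mu> \<sigma>"
    by (simp add: distributed_def)
  moreover have "distr std_normal_distribution lborel (\<lambda>x. \<mu> + \<sigma> * x)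
      = distr std_normal_distribution borel (\<lambda>x. \<mu> + \<sigma> * x)"
    by (intro distr_cong) auto
  ultimately show ?thesis by simp
qed

text \<open>A coordinatewise map pulls boxes back to boxes, and a product measure is determined by
  its values on boxes, so the claim reduces to the affine image of one standard Gaussian. The
  product form gives access to Fubini and to the independence behind Chebyshev's inequality.\<close>

lemma obs_law_eq_PiM:
  assumes "0 < \<sigma>"
  shows "obs_law d \<sigma> \<theta> = (\<Pi>\<^sub>M j\<in>{1..d}. gauss (\<theta> j) \<sigma>)"
proof -
  interpret N: product_prob_space "\<lambda>j::nat. std_normal_distribution"
    using product_prob_space_gauss[of 1 "\<lambda>_. 0"] by simp
  interpret G: product_prob_space "\<lambda>j. gauss (\<theta> j) \<sigma>"
    by (rule product_prob_space_gauss[OF assms])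
  let ?T = "\<lambda>\<xi>. \<lambda>j\<in>{1..d}. \<theta> j + \<sigma> * \<xi> j"
  have T: "?T \<in> noise_law d \<rightarrow>\<^sub>M borel_vec d"
    unfolding noise_law_def by measurable
  show ?thesis
  proof (rule G.PiM_eqI)
    show "sets (obs_law d \<sigma> \<theta>) = sets (\<Pi>\<^sub>M j\<in>{1..d}. gauss (\<theta> j) \<sigma>)"
      unfolding obs_law_def sets_distr by (intro sets_PiM_cong) auto
    fix A assume A: "\<And>j. j \<in> {1..d} \<Longrightarrow> A j \<in> sets (gauss (\<theta> j) \<sigma>)"
    have *: "(\<lambda>x. \<theta> j + \<sigma> * x) -` A j \<in> sets borel" if "j \<in> {1..d}" for j
    proof -
      have "(\<lambda>x. \<theta> j + \<sigma> * x) -` A j \<inter> space borel \<in> sets borel"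
        by (rule measurable_sets) (use A[OF that] in auto)
      then show ?thesis by simp
    qed
    have "emeasure (obs_law d \<sigma> \<theta>) (Pi\<^sub>E {1..d} A)
        = emeasure (noise_law d) (?T -` Pi\<^sub>E {1..d} A \<inter> space (noise_law d))"
      unfolding obs_law_def
      by (rule emeasure_distr[OF T]) (use A in \<open>auto intro!: sets_PiM_I_finite\<close>)
    also have "?T -` Pi\<^sub>E {1..d} A \<inter> space (noise_law d)
        = (\<Pi>\<^sub>E j\<in>{1..d}. (\<lambda>x. \<theta> j + \<sigma> * x) -` A j)"
      by (auto simp: noise_law_def space_PiM PiE_iff)
    also have "emeasure (noise_law d) \<dots>
        = (\<Prod>j\<in>{1..d}. emeasure std_normal_distribution ((\<lambda>x. \<theta> j + \<sigma> * x) -` A j))"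
      unfolding noise_law_def by (rule N.emeasure_PiM) (use * in auto)
    also have "\<dots> = (\<Prod>j\<in>{1..d}. emeasure (gauss (\<theta> j) \<sigma>) (A j))"
      by (intro prod.cong refl)
         (use A in \<open>simp add: distr_gauss_affine[OF assms, symmetric] emeasure_distr\<close>)
    finally show "emeasure (obs_law d \<sigma> \<theta>) (Pi\<^sub>E {1..d} A)
        = (\<Prod>j\<in>{1..d}. emeasure (gauss (\<theta> j) \<sigma>) (A j))" .
  qed simp
qed

lemma prob_space_obs_law: "0 < \<sigma> \<Longrightarrow> prob_space (obs_law d \<sigma> \<theta>)"
  by (simp add: obs_law_eq_PiM prob_space_PiM prob_space_normal_density)

lemma sets_obs_law [measurable_cong, simp]: "sets (obs_law d \<sigma> \<theta>) = sets (borel_vec d)"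
  by (simp add: obs_law_def)

lemma space_obs_law [simp]: "space (obs_law d \<sigma> \<theta>) = space (borel_vec d)"
  by (simp add: obs_law_def)

section \<open>Likelihood ratios against the null\<close>

definition lik_ratio :: "nat \<Rightarrow> real \<Rightarrow> (nat \<Rightarrow> real) \<Rightarrow> (nat \<Rightarrow> real) \<Rightarrow> real" where
  "lik_ratio d \<sigma> \<theta> y = (\<Prod>j\<in>{1..d}. exp ((\<theta> j * y j - (\<theta> j)\<^sup>2 / 2) / \<sigma>\<^sup>2))"

lemma lik_ratio_nonneg: "0 \<le> lik_ratio d \<sigma> \<theta> y"
  by (simp add: lik_ratio_def prod_nonneg)

lemma lik_ratio_measurable [measurable]: "lik_ratio d \<sigma> \<theta> \<in> borel_measurable (borel_vec d)"
  unfolding lik_ratio_def by measurable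

text \<open>Completing the square in the means leaves the cross term
  \<open>\<theta> j * \<eta> j\<close> in each exponent. Every likelihood ratio integrates to 1
  under the null, so the null expectation of the product is exactly the exponential factor.\<close>

lemma lik_ratio_mult:
  "lik_ratio d \<sigma> \<theta> y * lik_ratio d \<sigma> \<eta> y
     = exp ((\<Sum>j\<in>{1..d}. \<theta> j * \<eta> j) / \<sigma>\<^sup>2) * lik_ratio d \<sigma> (\<lambda>j. \<theta> j + \<eta> j) y"
proof -
  have "exp ((\<Sum>j\<in>{1..d}. \<theta> j * \<eta> j) / \<sigma>\<^sup>2) = (\<Prod>j\<in>{1..d}. exp (\<theta> j * \<eta> j / \<sigma>\<^sup>2))"
    by (simp add: exp_sum sum_divide_distrib)
  then show ?thesis
    unfolding lik_ratio_def prod.distrib[symmetric] exp_add[symmetric]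
    by (simp only: prod.distrib[symmetric] exp_add[symmetric] add_divide_distrib[symmetric])
       (intro prod.cong refl arg_cong[of _ _ exp] arg_cong[of _ _ "\<lambda>x. x / \<sigma>\<^sup>2"],
        simp add: power2_eq_square algebra_simps)
qed

text \<open>In each coordinate the terms quadratic in the observation cancel in the quotient of the
  two Gaussian densities, which leaves the factors of \<open>lik_ratio\<close>. Fubini multiplies
  them over boxes, and boxes determine the measure.\<close>

lemma obs_law_density:
  assumes "0 < \<sigma>"
  shows "obs_law d \<sigma> \<theta> = density (obs_law d \<sigma> (zero_vec d)) (lik_ratio d \<sigma> \<theta>)"
proof -
  interpret Z: product_prob_space "\<lambda>j. gauss (zero_vec d j) \<sigma>"
    by (rule product_prob_space_gauss[OF assms])
  interpret G: product_prob_space "\<lambda>j. gauss (\<theta> j) \<sigma>"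
    by (rule product_prob_space_gauss[OF assms])
  let ?l = "\<lambda>j x. exp ((\<theta> j * x - (\<theta> j)\<^sup>2 / 2) / \<sigma>\<^sup>2)"
  let ?Z = "\<Pi>\<^sub>M j\<in>{1..d}. gauss (zero_vec d j) \<sigma>"
  have nd: "normal_density (\<theta> j) \<sigma> x = normal_density (zero_vec d j) \<sigma> x * ?l j x" if "j \<in> {1..d}" for j x
  proof -
    have "- (x - \<theta> j)\<^sup>2 / (2 * \<sigma>\<^sup>2) = - (x - 0)\<^sup>2 / (2 * \<sigma>\<^sup>2) + (\<theta> j * x - (\<theta> j)\<^sup>2 / 2) / \<sigma>\<^sup>2"
      using assms by (simp add: field_simps power2_eq_square)
    then show ?thesis
      using that by (simp only: normal_density_def zero_vec_def exp_add) simp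
  qed
  have setsZ: "sets ?Z = sets (borel_vec d)"
    by (intro sets_PiM_cong) auto
  have [measurable]: "lik_ratio d \<sigma> \<theta> \<in> borel_measurable ?Z"
    using lik_ratio_measurable measurable_cong_sets[OF setsZ refl] by blast
  have "density ?Z (lik_ratio d \<sigma> \<theta>) = (\<Pi>\<^sub>M j\<in>{1..d}. gauss (\<theta> j) \<sigma>)"
  proof (rule G.PiM_eqI)
    show "sets (density ?Z (lik_ratio d \<sigma> \<theta>)) = sets (\<Pi>\<^sub>M j\<in>{1..d}. gauss (\<theta> j) \<sigma>)"
      unfolding sets_density by (intro sets_PiM_cong) auto
    fix A assume A: "\<And>j. j \<in> {1..d} \<Longrightarrow> A j \<in> sets (gauss (\<theta> j) \<sigma>)"
    then have A': "\<And>j. j \<in> {1..d} \<Longrightarrow> A j \<in> sets borel" by auto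
    have "emeasure (density ?Z (lik_ratio d \<sigma> \<theta>)) (Pi\<^sub>E {1..d} A)
        = (\<integral>\<^sup>+ y. ennreal (lik_ratio d \<sigma> \<theta> y) * indicator (Pi\<^sub>E {1..d} A) y \<partial>?Z)"
    proof (rule emeasure_density)
      show "Pi\<^sub>E {1..d} A \<in> sets ?Z"
        by (rule sets_PiM_I_finite) (use A' in simp_all)
    qed measurable
    also have "\<dots> = (\<integral>\<^sup>+ y. (\<Prod>j\<in>{1..d}. ennreal (?l j (y j)) * indicator (A j) (y j)) \<partial>?Z)"
    proof (rule nn_integral_cong)
      fix y assume "y \<in> space ?Z"
      then have "indicator (Pi\<^sub>E {1..d} A) y = (\<Prod>j\<in>{1..d}. indicator (A j) (y j) :: ennreal)"
        by (auto simp: space_PiM PiE_iff indicator_def prod_zero_iff)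
      then show "ennreal (lik_ratio d \<sigma> \<theta> y) * indicator (Pi\<^sub>E {1..d} A) y
          = (\<Prod>j\<in>{1..d}. ennreal (?l j (y j)) * indicator (A j) (y j))"
        by (simp add: lik_ratio_def prod.distrib prod_ennreal)
    qed
    also have "\<dots> = (\<Prod>j\<in>{1..d}. \<integral>\<^sup>+ x. ennreal (?l j x) * indicator (A j) x \<partial>gauss (zero_vec d j) \<sigma>)"
      by (rule Z.product_nn_integral_prod) (use A' in auto)
    also have "\<dots> = (\<Prod>j\<in>{1..d}. emeasure (gauss (\<theta> j) \<sigma>) (A j))"
    proof (intro prod.cong refl)
      fix j assume j: "j \<in> {1..d}"
      have [measurable]: "A j \<in> sets borel" by (rule A'[OF j])
      show "(\<integral>\<^sup>+ x. ennreal (?l j x) * indicator (A j) x \<partial>gauss (zero_vec d j) \<sigma>)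
          = emeasure (gauss (\<theta> j) \<sigma>) (A j)"
        by (simp add: nn_integral_density emeasure_density nd[OF j] ennreal_mult mult.assoc)
    qed
    finally show "emeasure (density ?Z (lik_ratio d \<sigma> \<theta>)) (Pi\<^sub>E {1..d} A)
        = (\<Prod>j\<in>{1..d}. emeasure (gauss (\<theta> j) \<sigma>) (A j))" .
  qed simp
  then show ?thesis by (simp add: obs_law_eq_PiM[OF assms])
qed

lemma lik_ratio_integral:
  assumes "0 < \<sigma>"
  shows "integrable (obs_law d \<sigma> (zero_vec d)) (lik_ratio d \<sigma> \<theta>)"
    and "(\<integral>y. lik_ratio d \<sigma> \<theta> y \<partial>obs_law d \<sigma> (zero_vec d)) = 1"
proof -
  interpret P: prob_space "obs_law d \<sigma> \<theta>"
    by (rule prob_space_obs_law[OF assms])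
  let ?Z = "obs_law d \<sigma> (zero_vec d)"
  have "integrable (density ?Z (lik_ratio d \<sigma> \<theta>)) (\<lambda>_. 1::real)"
    "(\<integral>y. 1 \<partial>density ?Z (lik_ratio d \<sigma> \<theta>)) = (1::real)"
    using P.prob_space by (simp_all flip: obs_law_density[OF assms])
  then show "integrable ?Z (lik_ratio d \<sigma> \<theta>)" "(\<integral>y. lik_ratio d \<sigma> \<theta> y \<partial>?Z) = 1"
    by (simp_all add: integrable_density integral_density lik_ratio_nonneg del: lebesgue_integral_const integral_const)
qed

section \<open>Tests and elementary bounds on the minimax risk\<close>

lemma sets_test: "\<Delta> \<in> tests d \<Longrightarrow> {y \<in> space (borel_vec d). \<Delta> y = k} \<in> sets (borel_vec d)"
proof -
  assume "\<Delta> \<in> tests d"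
  then have m: "\<Delta> \<in> borel_vec d \<rightarrow>\<^sub>M count_space {0, 1}" by (simp add: tests_def)
  have "\<Delta> -` ({k} \<inter> {0, 1}) \<inter> space (borel_vec d) \<in> sets (borel_vec d)"
    by (rule measurable_sets[OF m]) auto
  also have "\<Delta> -` ({k} \<inter> {0, 1}) \<inter> space (borel_vec d) = {y \<in> space (borel_vec d). \<Delta> y = k}"
    using measurable_space[OF m] by auto
  finally show ?thesis .
qed

lemma bdd_above_measure_obs_law:
  "0 < \<sigma> \<Longrightarrow> bdd_above ((\<lambda>\<theta>. measure (obs_law d \<sigma> \<theta>) B) ` T)"
  by (rule bdd_aboveI[of _ 1]) (auto intro: prob_space.prob_le_1 prob_space_obs_law)

text \<open>A real supremum has a usable value only over a nonempty bounded set, which is why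
  \<open>T\<close> is assumed nonempty here and in \<open>bdd_below_minimax_risk\<close>.\<close>

lemma SUP_measure_obs_law_nonneg:
  assumes "0 < \<sigma>" "T \<noteq> {}"
  shows "0 \<le> (SUP \<theta>\<in>T. measure (obs_law d \<sigma> \<theta>) B)"
proof -
  obtain \<theta> where "\<theta> \<in> T" using assms by auto
  then show ?thesis
    by (intro cSUP_upper2[where x = \<theta>] bdd_above_measure_obs_law assms) auto
qed

lemma bdd_below_minimax_risk:
  assumes "0 < \<sigma>" "T \<noteq> {}"
  shows "bdd_below ((\<lambda>\<Delta>. measure (obs_law d \<sigma> (zero_vec d)) {y \<in> space (borel_vec d). \<Delta> y = 1} +
        (SUP \<theta>\<in>T. measure (obs_law d \<sigma> \<theta>) {y \<in> space (borel_vec d). \<Delta> y = 0})) ` tests d)"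
  by (intro bdd_belowI2[where m = 0] add_nonneg_nonneg SUP_measure_obs_law_nonneg assms) auto

lemma tests_nonempty: "tests d \<noteq> {}"
proof -
  have "(\<lambda>_. 0) \<in> tests d" by (simp add: tests_def)
  then show ?thesis by auto
qed

lemma minimax_risk_le:
  assumes "0 < \<sigma>" "T \<noteq> {}" "\<Delta> \<in> tests d"
    and "measure (obs_law d \<sigma> (zero_vec d)) {y \<in> space (borel_vec d). \<Delta> y = 1} \<le> a"
    and "\<And>\<theta>. \<theta> \<in> T \<Longrightarrow> measure (obs_law d \<sigma> \<theta>) {y \<in> space (borel_vec d). \<Delta> y = 0} \<le> b"
  shows "minimax_risk d \<sigma> T \<le> a + b"
  unfolding minimax_risk_def
  by (rule cINF_lower2[OF bdd_below_minimax_risk[OF assms(1,2)] assms(3)])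
     (intro add_mono assms(4) cSUP_least assms(2,5))

text \<open>This carries lower bounds from \<open>Theta\<close> to \<open>Theta_star\<close>, and
  upper bounds in the opposite direction.\<close>

lemma minimax_risk_mono:
  assumes "0 < \<sigma>" "T \<noteq> {}" "T \<subseteq> T'"
  shows "minimax_risk d \<sigma> T \<le> minimax_risk d \<sigma> T'"
  unfolding minimax_risk_def
proof (intro cINF_mono tests_nonempty bdd_below_minimax_risk assms(1,2))
  fix \<Delta> :: "(nat \<Rightarrow> real) \<Rightarrow> nat" assume "\<Delta> \<in> tests d"
  then show "\<exists>\<Delta>'\<in>tests d.
      measure (obs_law d \<sigma> (zero_vec d)) {y \<in> space (borel_vec d). \<Delta>' y = 1} +
        (SUP \<theta>\<in>T. measure (obs_law d \<sigma> \<theta>) {y \<in> space (borel_vec d). \<Delta>' y = 0})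
      \<le> measure (obs_law d \<sigma> (zero_vec d)) {y \<in> space (borel_vec d). \<Delta> y = 1} +
        (SUP \<theta>\<in>T'. measure (obs_law d \<sigma> \<theta>) {y \<in> space (borel_vec d). \<Delta> y = 0})"
    by (intro bexI[of _ \<Delta>] add_left_mono cSUP_subset_mono bdd_above_measure_obs_law assms) auto
qed

section \<open>Lower bound from the second moment of a mixture likelihood ratio\<close>

text \<open>
  The double sum below is \<open>(card I)\<^sup>2\<close> times the second moment, under the null, of the likelihood ratio
  of the uniform mixture over \<open>t ` I\<close>.
\<close>

lemma minimax_risk_ge_chi_square:
  assumes \<sigma>: "0 < \<sigma>" and \<epsilon>: "0 < \<epsilon>" and I: "finite I" "I \<noteq> {}" and t: "\<And>i. i \<in> I \<Longrightarrow> t i \<in> T"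
    and chi: "(\<Sum>i\<in>I. \<Sum>k\<in>I. exp ((\<Sum>j\<in>{1..d}. t i j * t k j) / \<sigma>\<^sup>2)) \<le> (1 + \<epsilon>\<^sup>2) * (real (card I))\<^sup>2"
  shows "1 - \<epsilon> \<le> minimax_risk d \<sigma> T"
  unfolding minimax_risk_def
proof (rule cINF_greatest[OF tests_nonempty])
  fix \<Delta> assume \<Delta>: "\<Delta> \<in> tests d"
  define Z where "Z = obs_law d \<sigma> (zero_vec d)"
  interpret Z: prob_space Z unfolding Z_def by (rule prob_space_obs_law[OF \<sigma>])
  have Zs [simp]: "sets Z = sets (borel_vec d)" "space Z = space (borel_vec d)" by (simp_all add: Z_def)
  define B where "B = {y \<in> space (borel_vec d). \<Delta> y = 0}"
  define C where "C = {y \<in> space (borel_vec d). \<Delta> y = 1}"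
  have B: "B \<in> sets Z" and C: "C \<in> sets Z" using sets_test[OF \<Delta>] by (auto simp: B_def C_def)
  have "space Z - B = C"
    using \<Delta> by (auto simp: B_def C_def tests_def dest: measurable_space)
  then have PC: "measure Z C = 1 - measure Z B"
    using Z.prob_compl[OF B] by simp
  define c where "c = real (card I)"
  have c: "c > 0" using I by (simp add: c_def card_gt_0_iff)
  let ?l = "\<lambda>i. lik_ratio d \<sigma> (t i)"
  define L where "L y = (\<Sum>i\<in>I. ?l i y) / c" for y
  have int_l: "integrable Z (lik_ratio d \<sigma> \<theta>)" "(\<integral>y. lik_ratio d \<sigma> \<theta> y \<partial>Z) = 1" for \<theta>
    using lik_ratio_integral[OF \<sigma>] by (auto simp: Z_def)
  have int_L: "integrable Z L" "(\<integral>y. L y \<partial>Z) = 1"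
    using c unfolding L_def[abs_def] by (simp_all add: int_l flip: c_def)
  have L2: "(L y)\<^sup>2 = (\<Sum>i\<in>I. \<Sum>k\<in>I. exp ((\<Sum>j\<in>{1..d}. t i j * t k j) / \<sigma>\<^sup>2)
      * lik_ratio d \<sigma> (\<lambda>j. t i j + t k j) y) / c\<^sup>2" for y
    by (simp add: L_def power2_eq_square sum_product lik_ratio_mult)
  have int_L2: "integrable Z (\<lambda>y. (L y)\<^sup>2)" "(\<integral>y. (L y)\<^sup>2 \<partial>Z) \<le> 1 + \<epsilon>\<^sup>2"
    using chi c unfolding L2 by (simp_all add: int_l divide_le_eq flip: c_def)
  have int_LB: "integrable Z (\<lambda>y. lik_ratio d \<sigma> \<theta> y * indicator B y)"
    "(\<integral>y. lik_ratio d \<sigma> \<theta> y * indicator B y \<partial>Z) = measure (obs_law d \<sigma> \<theta>) B" for \<theta>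
  proof -
    show 1: "integrable Z (\<lambda>y. lik_ratio d \<sigma> \<theta> y * indicator B y)"
      by (rule integrable_real_mult_indicator[OF B int_l(1)])
    have "measure (obs_law d \<sigma> \<theta>) B = (\<integral>y. indicator B y \<partial>density Z (lik_ratio d \<sigma> \<theta>))"
      unfolding Z_def by (subst obs_law_density[OF \<sigma>]) (use B in \<open>simp add: Int_absorb2 sets.sets_into_space\<close>)
    also have "\<dots> = (\<integral>y. lik_ratio d \<sigma> \<theta> y * indicator B y \<partial>Z)"
      using B by (subst integral_density) (auto simp: lik_ratio_nonneg Z_def intro!: borel_measurable_indicator)
    finally show "(\<integral>y. lik_ratio d \<sigma> \<theta> y * indicator B y \<partial>Z) = measure (obs_law d \<sigma> \<theta>) B" ..
  qed
  \<comment> \<open>The worst type II error dominates the average over the prior, and that average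
    is the integral of \<open>L\<close> over \<open>B\<close>.\<close>
  define S where "S = (SUP \<theta>\<in>T. measure (obs_law d \<sigma> \<theta>) B)"
  have "(\<Sum>i\<in>I. measure (obs_law d \<sigma> (t i)) B) \<le> (\<Sum>i\<in>I. S)"
    unfolding S_def by (intro sum_mono cSUP_upper bdd_above_measure_obs_law \<sigma> t)
  then have S: "(\<Sum>i\<in>I. measure (obs_law d \<sigma> (t i)) B) / c \<le> S"
    using c by (simp add: divide_le_eq c_def mult.commute)
  have LB: "(\<lambda>y. L y * indicator B y) = (\<lambda>y. (\<Sum>i\<in>I. ?l i y * indicator B y) / c)"
    by (simp add: L_def sum_distrib_right)
  have int_LB': "integrable Z (\<lambda>y. L y * indicator B y)"
    "(\<integral>y. L y * indicator B y \<partial>Z) = (\<Sum>i\<in>I. measure (obs_law d \<sigma> (t i)) B) / c"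
    unfolding LB using int_LB by simp_all
  have int_B: "integrable Z (\<lambda>y. indicator B y :: real)" "(\<integral>y. indicator B y \<partial>Z) = measure Z B"
    using B by (auto simp: Int_absorb2 sets.sets_into_space intro!: integrable_real_indicator simp: less_top[symmetric])
  have "measure Z B - (\<integral>y. L y * indicator B y \<partial>Z) = (\<integral>y. indicator B y - L y * indicator B y \<partial>Z)"
    using int_B int_LB' by simp
  \<comment> \<open>On \<open>B\<close> this is
    \<open>2 * (1 - L) \<le> \<epsilon> + (1 - L)\<^sup>2 / \<epsilon>\<close>, which does the work
    of the Cauchy-Schwarz inequality; off \<open>B\<close> the left side is 0. Since
    \<open>L\<close> has mean 1, the integral of \<open>(1 - L)\<^sup>2\<close> is the second moment
    minus 1, at most \<open>\<epsilon>\<^sup>2\<close>, so the bound integrates to at most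
    \<open>\<epsilon>\<close>.\<close>
  also have "\<dots> \<le> (\<integral>y. (\<epsilon> + (1 - 2 * L y + (L y)\<^sup>2) / \<epsilon>) / 2 \<partial>Z)"
  proof (rule integral_mono)
    show "integrable Z (\<lambda>y. indicator B y - L y * indicator B y)"
      using int_B int_LB' by simp
    show "integrable Z (\<lambda>y. (\<epsilon> + (1 - 2 * L y + (L y)\<^sup>2) / \<epsilon>) / 2)"
      using int_L int_L2 by simp
    fix y
    have "0 \<le> (\<epsilon> - (1 - L y))\<^sup>2 / \<epsilon>" using \<epsilon> by simp
    also have "\<dots> = \<epsilon> - 2 * (1 - L y) + (1 - 2 * L y + (L y)\<^sup>2) / \<epsilon>"
      using \<epsilon> by (simp add: field_simps power2_eq_square)
    finally have 1: "2 * (1 - L y) \<le> \<epsilon> + (1 - 2 * L y + (L y)\<^sup>2) / \<epsilon>" by simp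
    have "1 - 2 * L y + (L y)\<^sup>2 = (1 - L y)\<^sup>2" by (simp add: power2_eq_square algebra_simps)
    then have 2: "0 \<le> \<epsilon> + (1 - 2 * L y + (L y)\<^sup>2) / \<epsilon>" using \<epsilon> by simp
    show "indicator B y - L y * indicator B y \<le> (\<epsilon> + (1 - 2 * L y + (L y)\<^sup>2) / \<epsilon>) / 2"
      using 1 2 by (cases "y \<in> B") auto
  qed
  also have "\<dots> = (\<epsilon> + ((\<integral>y. (L y)\<^sup>2 \<partial>Z) - 1) / \<epsilon>) / 2"
    using int_L int_L2 Z.prob_space by simp
  also have "\<dots> \<le> \<epsilon>"
    using int_L2(2) \<epsilon> by (simp add: field_simps power2_eq_square)
  finally have "1 - \<epsilon> \<le> measure Z C + S"
    using PC S int_LB'(2) by simp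
  then show "1 - \<epsilon> \<le> measure (obs_law d \<sigma> (zero_vec d)) {y \<in> space (borel_vec d). \<Delta> y = 1} +
      (SUP \<theta>\<in>T. measure (obs_law d \<sigma> \<theta>) {y \<in> space (borel_vec d). \<Delta> y = 0})"
    by (simp add: Z_def S_def B_def C_def)
qed

section \<open>The spike prior and its second moment\<close>

text \<open>
  \<open>f i\<close> holds the position and the sign of the single spike in block \<open>i\<close> (of length \<open>m\<close>). Choosing one
  position per block, rather than a uniform subset of size \<open>s\<close>, makes the blocks independent.
\<close>

definition spikes :: "nat \<Rightarrow> nat \<Rightarrow> nat \<Rightarrow> real \<Rightarrow> (nat \<Rightarrow> nat \<times> real) \<Rightarrow> nat \<Rightarrow> real" where
  "spikes d s m \<delta> f = (\<lambda>j\<in>{1..d}. let i = (j - 1) div m in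
     if i < s \<and> fst (f i) = (j - 1) mod m then \<delta> * snd (f i) else 0)"

context
  fixes d s m :: nat and \<delta> :: real and S :: "real set" and f :: "nat \<Rightarrow> nat \<times> real"
  assumes m: "0 < m" and sm: "s * m \<le> d" and \<delta>: "0 < \<delta>"
    and S: "S \<subseteq> {-1, 1}"
    and f: "f \<in> {..<s} \<rightarrow>\<^sub>E {..<m} \<times> S"
begin

text \<open>Coordinates are numbered from 1, blocks and positions inside a block from 0; hence the
  \<open>Suc\<close> here and the \<open>j - 1\<close> in \<open>spikes\<close>.\<close>

private abbreviation "pos i \<equiv> Suc (i * m + fst (f i))"

private lemma f_block: "i < s \<Longrightarrow> fst (f i) < m" "i < s \<Longrightarrow> snd (f i) \<in> S"
  using f by (auto simp: PiE_iff mem_Times_iff)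

private lemma block_le: "i < s \<Longrightarrow> k < m \<Longrightarrow> i * m + k < d"
proof -
  assume "i < s" "k < m"
  then have "i * m + k < Suc i * m" "Suc i * m \<le> s * m" by (simp, intro mult_right_mono) auto
  then show ?thesis using sm by linarith
qed

private lemma pos_inj: "inj_on pos {..<s}"
proof (rule inj_onI)
  fix i k assume "i \<in> {..<s}" "k \<in> {..<s}" "pos i = pos k"
  then have "(i * m + fst (f i)) div m = (k * m + fst (f k)) div m" by simp
  then show "i = k"
    using m f_block \<open>i \<in> {..<s}\<close> \<open>k \<in> {..<s}\<close> by simp
qed

private lemma spikes_pos: "i < s \<Longrightarrow> k < m \<Longrightarrow>
    spikes d s m \<delta> g (Suc (i * m + k)) = (if fst (g i) = k then \<delta> * snd (g i) else 0)"
  using block_le[of i k] m by (simp add: spikes_def)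

lemma spikes_support: "{j \<in> {1..d}. spikes d s m \<delta> f j \<noteq> 0} = pos ` {..<s}"
proof
  show "{j \<in> {1..d}. spikes d s m \<delta> f j \<noteq> 0} \<subseteq> pos ` {..<s}"
  proof
    fix j assume "j \<in> {j \<in> {1..d}. spikes d s m \<delta> f j \<noteq> 0}"
    then have "(j - 1) div m < s" "fst (f ((j - 1) div m)) = (j - 1) mod m" "1 \<le> j"
      by (auto simp: spikes_def Let_def split: if_splits)
    then have "j = pos ((j - 1) div m)" "(j - 1) div m \<in> {..<s}" by simp_all
    then show "j \<in> pos ` {..<s}" by (rule image_eqI)
  qed
  show "pos ` {..<s} \<subseteq> {j \<in> {1..d}. spikes d s m \<delta> f j \<noteq> 0}"
  proof
    fix j assume "j \<in> pos ` {..<s}"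
    then obtain i where i: "i < s" "j = pos i" by auto
    then show "j \<in> {j \<in> {1..d}. spikes d s m \<delta> f j \<noteq> 0}"
      using f_block[OF i(1)] block_le[OF i(1)] S \<delta> by (auto simp: spikes_pos less_imp_le Suc_le_eq)
  qed
qed

lemma spikes_l0: "l0_norm d (spikes d s m \<delta> f) = s"
  unfolding l0_norm_def spikes_support by (simp add: card_image pos_inj)

lemma spikes_values: "j \<in> {1..d} \<Longrightarrow> spikes d s m \<delta> f j \<in> insert 0 ((*) \<delta> ` S)"
  using f_block by (auto simp: spikes_def Let_def)

text \<open>Only the coordinates carrying a spike of \<open>f\<close> count, and there is one per
  block; it meets a spike of \<open>g\<close> exactly when the two positions in the block agree. A
  sum over blocks is what turns into a product over blocks under the exponential.\<close>

lemma spikes_inner: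
  "(\<Sum>j\<in>{1..d}. spikes d s m \<delta> f j * spikes d s m \<delta> g j)
     = (\<Sum>i<s. if fst (f i) = fst (g i) then \<delta>\<^sup>2 * snd (f i) * snd (g i) else 0)"
proof -
  have "(\<Sum>j\<in>{1..d}. spikes d s m \<delta> f j * spikes d s m \<delta> g j)
      = (\<Sum>j\<in>pos ` {..<s}. spikes d s m \<delta> f j * spikes d s m \<delta> g j)"
    by (rule sum.mono_neutral_right) (use spikes_support in auto)
  also have "\<dots> = (\<Sum>i<s. spikes d s m \<delta> f (pos i) * spikes d s m \<delta> g (pos i))"
    by (simp add: sum.reindex pos_inj)
  also have "\<dots> = (\<Sum>i<s. if fst (f i) = fst (g i) then \<delta>\<^sup>2 * snd (f i) * snd (g i) else 0)"
    by (intro sum.cong refl) (auto simp: spikes_pos f_block power2_eq_square)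
  finally show ?thesis .
qed

lemma spikes_in_Theta: "S = {1} \<Longrightarrow> spikes d s m \<delta> f \<in> Theta d s \<delta>"
  using spikes_l0 spikes_values by (auto simp: Theta_def spikes_def)

lemma spikes_in_Theta_star:
  assumes "1 \<le> s"
  shows "spikes d s m \<delta> f \<in> Theta_star d s \<delta>"
proof -
  have "\<bar>spikes d s m \<delta> f j\<bar> = \<delta>" if "j \<in> {1..d}" "spikes d s m \<delta> f j \<noteq> 0" for j
    using spikes_values[OF that(1)] that(2) S \<delta> by auto
  moreover have "{j \<in> {1..d}. spikes d s m \<delta> f j \<noteq> 0} \<noteq> {}"
    unfolding spikes_support using assms by (auto simp: lessThan_empty_iff bot_nat_def)
  ultimately have "\<delta> \<le> Min ((\<lambda>j. \<bar>spikes d s m \<delta> f j\<bar>) ` {j \<in> {1..d}. spikes d s m \<delta> f j \<noteq> 0})"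
    by (subst Min_ge_iff) auto
  then show ?thesis
    using spikes_l0 by (auto simp: Theta_star_def spikes_def)
qed

end

text \<open>Distributivity applied twice, first to \<open>g\<close> and then to \<open>f\<close>. It
  expresses the independence of the blocks: the double sum over the prior factorises into identical
  sums for a single block.\<close>

lemma sum_PiE_prod_pairs:
  fixes w :: "'a \<Rightarrow> 'a \<Rightarrow> 'c :: comm_semiring_1"
  assumes "finite N" "finite B"
  shows "(\<Sum>f\<in>N \<rightarrow>\<^sub>E B. \<Sum>g\<in>N \<rightarrow>\<^sub>E B. \<Prod>i\<in>N. w (f i) (g i)) = (\<Sum>a\<in>B. \<Sum>b\<in>B. w a b) ^ card N"
proof -
  have "(\<Sum>f\<in>N \<rightarrow>\<^sub>E B. \<Sum>g\<in>N \<rightarrow>\<^sub>E B. \<Prod>i\<in>N. w (f i) (g i))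
      = (\<Sum>f\<in>N \<rightarrow>\<^sub>E B. \<Prod>i\<in>N. \<Sum>b\<in>B. w (f i) b)"
    using assms by (intro sum.cong refl prod_sum_PiE[symmetric])
  also have "\<dots> = (\<Prod>i\<in>N. \<Sum>a\<in>B. \<Sum>b\<in>B. w a b)"
    using assms by (intro prod_sum_PiE[symmetric])
  finally show ?thesis by simp
qed

text \<open>Two independent draws from the prior collide in a given block with probability
  \<open>1 / m\<close>, and \<open>1 + \<kappa>\<close> is the mean of the exponential over two
  independent signs given a collision. Each block thus contributes a factor
  \<open>1 + \<kappa> / m\<close> to the second moment, and the product over \<open>s\<close> blocks
  is at most \<open>exp (s * \<kappa> / m)\<close>.\<close>

lemma minimax_risk_ge_spikes:
  assumes \<sigma>: "0 < \<sigma>" and \<epsilon>: "0 < \<epsilon>" and sd: "1 \<le> s" "s \<le> d" and \<delta>: "0 < \<delta>"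
    and S: "S \<subseteq> {-1, 1}" "S \<noteq> {}"
    and T: "\<And>m f. 0 < m \<Longrightarrow> s * m \<le> d \<Longrightarrow> f \<in> {..<s} \<rightarrow>\<^sub>E {..<m} \<times> S \<Longrightarrow> spikes d s m \<delta> f \<in> T"
    and \<kappa>: "0 \<le> \<kappa>" "(\<Sum>u\<in>S. \<Sum>v\<in>S. exp (\<delta>\<^sup>2 * u * v / \<sigma>\<^sup>2)) = (1 + \<kappa>) * (real (card S))\<^sup>2"
    and bound: "exp (2 * (real s)\<^sup>2 * \<kappa> / real d) \<le> 1 + \<epsilon>\<^sup>2"
  shows "1 - \<epsilon> \<le> minimax_risk d \<sigma> T"
proof -
  define m where "m = d div s"
  have m: "0 < m" using sd by (simp add: m_def div_greater_zero_iff)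
  have sm: "s * m \<le> d" by (simp add: m_def)
  \<comment> \<open>The uncovered remainder \<open>d mod s\<close> is less than \<open>s\<close>,
    hence less than \<open>s * m\<close>: the blocks cover more than half of the coordinates. This
    is the source of the factor 2 in \<open>bound\<close>.\<close>
  have "d < 2 * (s * m)"
  proof -
    have "d = s * m + d mod s" "d mod s < s" using sd by (simp_all add: m_def)
    moreover have "s \<le> s * m" using m by simp
    ultimately show ?thesis by linarith
  qed
  then have "real d < 2 * (real s * real m)" by (metis of_nat_less_iff of_nat_mult of_nat_numeral)
  then have sm2: "real s / real m \<le> 2 * (real s)\<^sup>2 / real d"
    using m sd by (simp add: field_simps power2_eq_square)
  let ?B = "{..<m} \<times> S" and ?I = "{..<s} \<rightarrow>\<^sub>E {..<m} \<times> S"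
  have fS: "finite S" using S(1) finite_subset by blast
  define c where "c = real (card S)"
  have c: "c > 0" using S fS by (simp add: c_def card_gt_0_iff)
  let ?w = "\<lambda>a b. exp ((if fst a = fst b then \<delta>\<^sup>2 * snd a * snd b else 0) / \<sigma>\<^sup>2)"
  have "(\<Sum>a\<in>?B. \<Sum>b\<in>?B. ?w a b)
      = (\<Sum>k<m. \<Sum>u\<in>S. \<Sum>l<m. \<Sum>v\<in>S. if k = l then exp (\<delta>\<^sup>2 * u * v / \<sigma>\<^sup>2) else 1)"
    unfolding sum.cartesian_product' by (intro sum.cong refl) auto
  also have "\<dots> = (\<Sum>k<m. \<Sum>l<m. \<Sum>u\<in>S. \<Sum>v\<in>S. if k = l then exp (\<delta>\<^sup>2 * u * v / \<sigma>\<^sup>2) else 1)"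
    by (intro sum.cong refl sum.swap)
  \<comment> \<open>Distinct positions give \<open>c\<^sup>2\<close> sign pairs with value 1 each;
    equal positions give \<open>(1 + \<kappa>) * c\<^sup>2\<close> by the assumption on
    \<open>\<kappa>\<close>.\<close>
  also have "\<dots> = (\<Sum>k<m. \<Sum>l<m. c\<^sup>2 + (if k = l then \<kappa> * c\<^sup>2 else 0))"
    by (intro sum.cong refl) (auto simp: \<kappa>(2) c_def distrib_right, simp add: power2_eq_square)
  also have "\<dots> = (real m * c)\<^sup>2 * (1 + \<kappa> / real m)"
    using m by (simp add: sum.distrib field_simps power2_eq_square)
  finally have B: "(\<Sum>a\<in>?B. \<Sum>b\<in>?B. ?w a b) = (real m * c)\<^sup>2 * (1 + \<kappa> / real m)" .
  have "(\<Sum>f\<in>?I. \<Sum>g\<in>?I. exp ((\<Sum>j\<in>{1..d}. spikes d s m \<delta> f j * spikes d s m \<delta> g j) / \<sigma>\<^sup>2))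
      = (\<Sum>f\<in>?I. \<Sum>g\<in>?I. \<Prod>i<s. ?w (f i) (g i))"
    by (intro sum.cong refl)
       (simp only: spikes_inner[OF m sm \<delta> S(1)] sum_divide_distrib exp_sum finite_lessThan)
  also have "\<dots> = ((real m * c)\<^sup>2 * (1 + \<kappa> / real m)) ^ s"
    using fS by (subst sum_PiE_prod_pairs) (simp_all add: B)
  also have "\<dots> = (1 + \<kappa> / real m) ^ s * (real (card ?I))\<^sup>2"
    by (simp add: card_PiE card_cartesian_product c_def power_mult_distrib power2_eq_square)
  also have "\<dots> \<le> (1 + \<epsilon>\<^sup>2) * (real (card ?I))\<^sup>2"
  proof (rule mult_right_mono)
    have "(1 + \<kappa> / real m) ^ s \<le> exp (\<kappa> / real m) ^ s"
      using \<kappa>(1) by (intro power_mono exp_ge_add_one_self) auto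
    also have "\<dots> = exp (real s / real m * \<kappa>)"
      by (simp add: exp_of_nat_mult[symmetric])
    also have "\<dots> \<le> exp (2 * (real s)\<^sup>2 / real d * \<kappa>)"
      using mult_right_mono[OF sm2 \<kappa>(1)] by simp
    finally show "(1 + \<kappa> / real m) ^ s \<le> 1 + \<epsilon>\<^sup>2" using bound by simp
  qed simp
  finally show ?thesis
  proof (rule minimax_risk_ge_chi_square[OF \<sigma> \<epsilon>, rotated 3])
    show "finite ?I" using fS by (intro finite_PiE) auto
    show "?I \<noteq> {}" using m S(2) by (auto simp: PiE_eq_empty_iff)
    show "spikes d s m \<delta> f \<in> T" if "f \<in> ?I" for f by (rule T[OF m sm that])
  qed
qed

section \<open>Chebyshev's inequality for sums over a product measure\<close>

context product_prob_space
begin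

lemma PiM_component_integral:
  fixes g :: "'a \<Rightarrow> real"
  assumes "j \<in> N" "integrable (M j) g"
  shows "integrable (PiM N M) (\<lambda>y. g (y j))" "(\<integral>y. g (y j) \<partial>PiM N M) = integral\<^sup>L (M j) g"
proof -
  have D: "distr (PiM N M) (M j) (\<lambda>y. y j) = M j"
    by (rule distr_PiM_component) (auto simp: assms prob_space)
  have m: "(\<lambda>y. y j) \<in> PiM N M \<rightarrow>\<^sub>M M j" using assms(1) by measurable
  have g: "g \<in> borel_measurable (M j)" using assms(2) by auto
  show "integrable (PiM N M) (\<lambda>y. g (y j))"
    using integrable_distr_eq[OF m g] D assms(2) by simp
  show "(\<integral>y. g (y j) \<partial>PiM N M) = integral\<^sup>L (M j) g"
    using integral_distr[OF m g] D by simp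
qed

lemma PiM_pair_integral:
  fixes g h :: "'a \<Rightarrow> real"
  assumes N: "finite N" and jk: "j \<in> N" "k \<in> N" "j \<noteq> k"
    and g: "integrable (M j) g" and h: "integrable (M k) h"
  shows "integrable (PiM N M) (\<lambda>y. g (y j) * h (y k))"
    "(\<integral>y. g (y j) * h (y k) \<partial>PiM N M) = integral\<^sup>L (M j) g * integral\<^sup>L (M k) h"
proof -
  \<comment> \<open>Padding with the constant 1 in all other coordinates makes the pair a full
    product over \<open>N\<close>, to which the product form of Fubini applies.\<close>
  define f where "f i x = (if i = j then g x else 1) * (if i = k then h x else 1)" for i x
  have f: "integrable (M i) (f i)" for i
    using g h jk(3) unfolding f_def by (cases "i = j"; cases "i = k") auto
  have If: "integral\<^sup>L (M i) (f i)
      = (if i = j then integral\<^sup>L (M j) g else 1) * (if i = k then integral\<^sup>L (M k) h else 1)" for i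
    using jk(3) M.prob_space unfolding f_def by (cases "i = j"; cases "i = k") auto
  have eq: "(\<Prod>i\<in>N. f i (y i)) = g (y j) * h (y k)" for y
    unfolding f_def prod.distrib using N jk by simp
  show "integrable (PiM N M) (\<lambda>y. g (y j) * h (y k))"
    using product_integrable_prod[OF N, of f] f by (simp add: eq)
  show "(\<integral>y. g (y j) * h (y k) \<partial>PiM N M) = integral\<^sup>L (M j) g * integral\<^sup>L (M k) h"
    using product_integral_prod[OF N, of f] f N jk by (simp add: eq If prod.distrib)
qed

text \<open>After centring, the off-diagonal products integrate to 0 by independence, so the second
  moment of the sum is the sum of the variances. The factors \<open>M j\<close> may differ, as they
  do under the alternative.\<close>

lemma PiM_Chebyshev:
  fixes \<phi> :: "'a \<Rightarrow> real"
  assumes N: "finite N" and \<phi>: "\<And>j. j \<in> N \<Longrightarrow> \<phi> \<in> borel_measurable (M j)"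
    and \<phi>2: "\<And>j. j \<in> N \<Longrightarrow> integrable (M j) (\<lambda>x. (\<phi> x)\<^sup>2)" and a: "0 < a"
  shows "measure (PiM N M) {y \<in> space (PiM N M). a \<le> \<bar>(\<Sum>j\<in>N. \<phi> (y j)) - (\<Sum>j\<in>N. integral\<^sup>L (M j) \<phi>)\<bar>}
    \<le> (\<Sum>j\<in>N. \<integral>x. (\<phi> x - integral\<^sup>L (M j) \<phi>)\<^sup>2 \<partial>M j) / a\<^sup>2"
proof -
  interpret PN: prob_space "PiM N M" by (rule prob_space_PiM) (rule prob_space)
  define \<psi> where "\<psi> j x = \<phi> x - integral\<^sup>L (M j) \<phi>" for j x
  have \<phi>1: "integrable (M j) \<phi>" if "j \<in> N" for j
    using M.square_integrable_imp_integrable \<phi> \<phi>2 that by blast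
  have \<psi>1: "integrable (M j) (\<psi> j)" "integral\<^sup>L (M j) (\<psi> j) = 0" if "j \<in> N" for j
    using \<phi>1[OF that] M.prob_space unfolding \<psi>_def by auto
  have \<psi>2: "integrable (M j) (\<lambda>x. (\<psi> j x)\<^sup>2)" if "j \<in> N" for j
    using \<phi>1[OF that] \<phi>2[OF that] unfolding \<psi>_def power2_diff by auto
  let ?F = "\<lambda>y. \<Sum>j\<in>N. \<psi> j (y j)"
  have F2: "(?F y)\<^sup>2 = (\<Sum>j\<in>N. \<Sum>k\<in>N. \<psi> j (y j) * \<psi> k (y k))" for y
    by (simp add: power2_eq_square sum_product)
  have pair: "integrable (PiM N M) (\<lambda>y. \<psi> j (y j) * \<psi> k (y k)) \<and>
      (\<integral>y. \<psi> j (y j) * \<psi> k (y k) \<partial>PiM N M) = (if j = k then \<integral>x. (\<psi> j x)\<^sup>2 \<partial>M j else 0)"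
    if "j \<in> N" "k \<in> N" for j k
  proof (cases "j = k")
    case True
    then show ?thesis
      using PiM_component_integral[OF that(1) \<psi>2[OF that(1)]] by (simp add: power2_eq_square)
  next
    case False
    then show ?thesis
      using PiM_pair_integral[OF N that False \<psi>1(1)[OF that(1)] \<psi>1(1)[OF that(2)]] \<psi>1(2) that by simp
  qed
  have F_meas: "?F \<in> borel_measurable (PiM N M)"
    by (intro borel_measurable_sum borel_measurable_integrable PiM_component_integral(1) \<psi>1(1))
  have "integrable (PiM N M) (\<lambda>y. (?F y)\<^sup>2)"
    unfolding F2 using pair by (intro Bochner_Integration.integrable_sum) auto
  then have "measure (PiM N M) {y \<in> space (PiM N M). a \<le> \<bar>?F y\<bar>} \<le> (\<integral>y. (?F y)\<^sup>2 \<partial>PiM N M) / a\<^sup>2"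
    by (rule PN.second_moment_method[OF F_meas _ a])
  also have "(\<integral>y. (?F y)\<^sup>2 \<partial>PiM N M) = (\<Sum>j\<in>N. \<integral>x. (\<psi> j x)\<^sup>2 \<partial>M j)"
    unfolding F2 using pair N
    by (simp add: Bochner_Integration.integral_sum Bochner_Integration.integrable_sum)
  finally show ?thesis
    by (simp add: \<psi>_def sum_subtractf)
qed

end

section \<open>Tests based on a sum over the coordinates\<close>

text \<open>The test rejects when the sum reaches its null mean plus \<open>c\<^sub>0\<close>. A
  wrong decision then forces a deviation from the true mean of at least \<open>c\<^sub>0\<close>
  under the null and \<open>c\<close> under the alternative, and Chebyshev's inequality allots
  \<open>\<epsilon> / 2\<close> to each. The margin \<open>c\<close> may depend on
  \<open>\<theta>\<close>, since the variance may grow with \<open>\<theta>\<close>.\<close>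

lemma minimax_risk_le_sum_test:
  fixes d :: nat and \<sigma> :: real and \<phi> :: "real \<Rightarrow> real"
  defines "E \<equiv> \<lambda>\<mu>. \<integral>x. \<phi> x \<partial>gauss \<mu> \<sigma>"
  defines "V \<equiv> \<lambda>\<mu>. \<integral>x. (\<phi> x - E \<mu>)\<^sup>2 \<partial>gauss \<mu> \<sigma>"
  assumes \<sigma>: "0 < \<sigma>" and T: "T \<noteq> {}" and \<phi>: "\<phi> \<in> borel_measurable borel"
    and \<phi>2: "\<And>\<mu>. integrable (gauss \<mu> \<sigma>) (\<lambda>x. (\<phi> x)\<^sup>2)"
    and null: "0 < c\<^sub>0" "real d * V 0 / c\<^sub>0\<^sup>2 \<le> \<epsilon> / 2"
    and alt: "\<And>\<theta>. \<theta> \<in> T \<Longrightarrow> \<exists>c>0. real d * E 0 + c\<^sub>0 + c \<le> (\<Sum>j\<in>{1..d}. E (\<theta> j)) \<and>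
                (\<Sum>j\<in>{1..d}. V (\<theta> j)) / c\<^sup>2 \<le> \<epsilon> / 2"
  shows "minimax_risk d \<sigma> T \<le> \<epsilon>"
proof -
  define \<tau> where "\<tau> = real d * E 0 + c\<^sub>0"
  define \<Delta> :: "(nat \<Rightarrow> real) \<Rightarrow> nat" where "\<Delta> y = (if \<tau> \<le> (\<Sum>j\<in>{1..d}. \<phi> (y j)) then 1 else 0)" for y
  note [measurable] = \<phi>
  have \<Delta>: "\<Delta> \<in> tests d"
    unfolding tests_def \<Delta>_def[abs_def] by measurable
  have cheb: "measure (obs_law d \<sigma> \<theta>)
      {y \<in> space (borel_vec d). c \<le> \<bar>(\<Sum>j\<in>{1..d}. \<phi> (y j)) - (\<Sum>j\<in>{1..d}. E (\<theta> j))\<bar>}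
      \<le> (\<Sum>j\<in>{1..d}. V (\<theta> j)) / c\<^sup>2" if "0 < c" for \<theta> c
  proof -
    interpret G: product_prob_space "\<lambda>j. gauss (\<theta> j) \<sigma>"
      by (rule product_prob_space_gauss[OF \<sigma>])
    have "space (\<Pi>\<^sub>M j\<in>{1..d}. gauss (\<theta> j) \<sigma>) = space (borel_vec d)"
      by (simp add: space_PiM)
    moreover have "measure (\<Pi>\<^sub>M j\<in>{1..d}. gauss (\<theta> j) \<sigma>)
        {y \<in> space (\<Pi>\<^sub>M j\<in>{1..d}. gauss (\<theta> j) \<sigma>).
          c \<le> \<bar>(\<Sum>j\<in>{1..d}. \<phi> (y j)) - (\<Sum>j\<in>{1..d}. E (\<theta> j))\<bar>}
        \<le> (\<Sum>j\<in>{1..d}. V (\<theta> j)) / c\<^sup>2"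
      unfolding E_def V_def by (rule G.PiM_Chebyshev) (simp_all add: \<phi> \<phi>2 that)
    ultimately show ?thesis
      by (simp only: obs_law_eq_PiM[OF \<sigma>])
  qed
  have le: "measure (obs_law d \<sigma> \<theta>) {y \<in> space (borel_vec d). \<Delta> y = k}
      \<le> (\<Sum>j\<in>{1..d}. V (\<theta> j)) / c\<^sup>2"
    if "0 < c" and "\<And>y. \<Delta> y = k \<Longrightarrow> c \<le> \<bar>(\<Sum>j\<in>{1..d}. \<phi> (y j)) - (\<Sum>j\<in>{1..d}. E (\<theta> j))\<bar>" for \<theta> k c
  proof -
    interpret P: prob_space "obs_law d \<sigma> \<theta>" by (rule prob_space_obs_law[OF \<sigma>])
    have S: "{y \<in> space (borel_vec d). c \<le> \<bar>(\<Sum>j\<in>{1..d}. \<phi> (y j)) - (\<Sum>j\<in>{1..d}. E (\<theta> j))\<bar>}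
        \<in> sets (borel_vec d)"
      by measurable
    have "measure (obs_law d \<sigma> \<theta>) {y \<in> space (borel_vec d). \<Delta> y = k}
        \<le> measure (obs_law d \<sigma> \<theta>)
          {y \<in> space (borel_vec d). c \<le> \<bar>(\<Sum>j\<in>{1..d}. \<phi> (y j)) - (\<Sum>j\<in>{1..d}. E (\<theta> j))\<bar>}"
      
    proof (rule P.finite_measure_mono)
      show "{y \<in> space (borel_vec d). \<Delta> y = k} \<subseteq> {y \<in> space (borel_vec d).
          c \<le> \<bar>(\<Sum>j\<in>{1..d}. \<phi> (y j)) - (\<Sum>j\<in>{1..d}. E (\<theta> j))\<bar>}"
        by (intro Collect_mono impI conjI) (erule conjunct1, erule conjE, rule that(2))
    qed (simp only: sets_obs_law S)
    also have "\<dots> \<le> (\<Sum>j\<in>{1..d}. V (\<theta> j)) / c\<^sup>2" by (rule cheb[OF that(1)])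
    finally show ?thesis .
  qed
  have E0: "(\<Sum>j\<in>{1..d}. E (zero_vec d j)) = real d * E 0" "(\<Sum>j\<in>{1..d}. V (zero_vec d j)) = real d * V 0"
    by (simp_all add: zero_vec_def)
  have "minimax_risk d \<sigma> T \<le> \<epsilon> / 2 + \<epsilon> / 2"
  proof (rule minimax_risk_le[OF \<sigma> T \<Delta>])
    have "c\<^sub>0 \<le> \<bar>(\<Sum>j\<in>{1..d}. \<phi> (y j)) - (\<Sum>j\<in>{1..d}. E (zero_vec d j))\<bar>" if "\<Delta> y = 1" for y
    proof -
      have "\<tau> \<le> (\<Sum>j\<in>{1..d}. \<phi> (y j))" by (rule ccontr) (use that in \<open>simp add: \<Delta>_def\<close>)
      then show ?thesis unfolding E0 \<tau>_def by linarith
    qed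
    from order_trans[OF le[OF null(1) this]] null(2)
    show "measure (obs_law d \<sigma> (zero_vec d)) {y \<in> space (borel_vec d). \<Delta> y = 1} \<le> \<epsilon> / 2"
      unfolding E0 by blast
  next
    fix \<theta> assume "\<theta> \<in> T"
    then obtain c where c: "0 < c" "\<tau> + c \<le> (\<Sum>j\<in>{1..d}. E (\<theta> j))" "(\<Sum>j\<in>{1..d}. V (\<theta> j)) / c\<^sup>2 \<le> \<epsilon> / 2"
      using alt[OF \<open>\<theta> \<in> T\<close>] unfolding \<tau>_def by blast
    have "c \<le> \<bar>(\<Sum>j\<in>{1..d}. \<phi> (y j)) - (\<Sum>j\<in>{1..d}. E (\<theta> j))\<bar>" if "\<Delta> y = 0" for y
    proof -
      have "(\<Sum>j\<in>{1..d}. \<phi> (y j)) < \<tau>" by (rule ccontr) (use that in \<open>simp add: \<Delta>_def\<close>)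
      then show ?thesis using c(2) by linarith
    qed
    from order_trans[OF le[OF c(1) this]] c(3)
    show "measure (obs_law d \<sigma> \<theta>) {y \<in> space (borel_vec d). \<Delta> y = 0} \<le> \<epsilon> / 2"
      by blast
  qed
  then show ?thesis by simp
qed

section \<open>Gaussian tails and moments\<close>

text \<open>Change of measure to the Gaussian centred at the edge of the half-line: on the half-line
  the original density is at most \<open>exp (- t\<^sup>2 / 2)\<close> times the shifted one, whose
  total mass is 1. The sign \<open>e\<close> selects the side.\<close>

lemma gauss_tail_one_sided:
  assumes \<sigma>: "0 < \<sigma>" and t: "0 \<le> t" and e: "e \<in> {-1, 1}"
  shows "measure (gauss \<mu> \<sigma>) {x. \<sigma> * t \<le> e * (x - \<mu>)} \<le> exp (- t\<^sup>2 / 2)"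
proof -
  let ?A = "{x. \<sigma> * t \<le> e * (x - \<mu>)}" and ?\<nu> = "\<mu> + e * \<sigma> * t"
  interpret P: prob_space "gauss \<mu> \<sigma>" by (rule prob_space_normal_density[OF \<sigma>])
  interpret Q: prob_space "gauss ?\<nu> \<sigma>" by (rule prob_space_normal_density[OF \<sigma>])
  have pt: "normal_density \<mu> \<sigma> x \<le> exp (- t\<^sup>2 / 2) * normal_density ?\<nu> \<sigma> x" if "x \<in> ?A" for x
  proof -
    have e2: "e * e = 1" using e by auto
    have "- (x - ?\<nu>)\<^sup>2 = - (x - \<mu>)\<^sup>2 + 2 * (\<sigma> * t) * (e * (x - \<mu>)) - (e * e) * (\<sigma> * t)\<^sup>2"
      by (simp add: power2_eq_square algebra_simps)
    moreover have "2 * (\<sigma> * t) * (\<sigma> * t) \<le> 2 * (\<sigma> * t) * (e * (x - \<mu>))"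
      using that \<sigma> t by (intro mult_left_mono) auto
    ultimately have "- (x - \<mu>)\<^sup>2 \<le> - (x - ?\<nu>)\<^sup>2 - (\<sigma> * t)\<^sup>2"
      unfolding e2 power2_eq_square[of "\<sigma> * t"] mult_1 by linarith
    then have "- (x - \<mu>)\<^sup>2 / (2 * \<sigma>\<^sup>2) \<le> (- (x - ?\<nu>)\<^sup>2 - (\<sigma> * t)\<^sup>2) / (2 * \<sigma>\<^sup>2)"
      using \<sigma> by (intro divide_right_mono) auto
    also have "\<dots> = - t\<^sup>2 / 2 + - (x - ?\<nu>)\<^sup>2 / (2 * \<sigma>\<^sup>2)"
      using \<sigma> by (simp add: field_simps)
    finally have "exp (- (x - \<mu>)\<^sup>2 / (2 * \<sigma>\<^sup>2)) \<le> exp (- t\<^sup>2 / 2) * exp (- (x - ?\<nu>)\<^sup>2 / (2 * \<sigma>\<^sup>2))"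
      by (simp only: exp_add[symmetric] exp_le_cancel_iff)
    then have "1 / sqrt (2 * pi * \<sigma>\<^sup>2) * exp (- (x - \<mu>)\<^sup>2 / (2 * \<sigma>\<^sup>2))
        \<le> 1 / sqrt (2 * pi * \<sigma>\<^sup>2) * (exp (- t\<^sup>2 / 2) * exp (- (x - ?\<nu>)\<^sup>2 / (2 * \<sigma>\<^sup>2)))"
      by (intro mult_left_mono) auto
    then show ?thesis
      by (simp only: normal_density_def mult.left_commute)
  qed
  have "emeasure (gauss \<mu> \<sigma>) ?A = (\<integral>\<^sup>+x. ennreal (normal_density \<mu> \<sigma> x) * indicator ?A x \<partial>lborel)"
    by (intro emeasure_density) auto
  also have "\<dots> \<le> (\<integral>\<^sup>+x. ennreal (exp (- t\<^sup>2 / 2)) * ennreal (normal_density ?\<nu> \<sigma> x) \<partial>lborel)"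
    using pt by (intro nn_integral_mono)
      (auto simp: indicator_def ennreal_mult[symmetric] normal_density_nonneg intro!: ennreal_leI)
  also have "\<dots> = ennreal (exp (- t\<^sup>2 / 2)) * emeasure (gauss ?\<nu> \<sigma>) (space (gauss ?\<nu> \<sigma>))"
    by (subst nn_integral_cmult) (auto simp: emeasure_density)
  also have "\<dots> = ennreal (exp (- t\<^sup>2 / 2))"
    unfolding Q.emeasure_space_1 by simp
  finally show ?thesis
    unfolding P.emeasure_eq_measure by simp
qed

lemma gauss_tail:
  assumes \<sigma>: "0 < \<sigma>" and t: "0 \<le> t"
  shows "measure (gauss \<mu> \<sigma>) {x. \<sigma> * t \<le> \<bar>x - \<mu>\<bar>} \<le> 2 * exp (- t\<^sup>2 / 2)"
proof -
  interpret P: prob_space "gauss \<mu> \<sigma>" by (rule prob_space_normal_density[OF \<sigma>])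
  let ?A = "\<lambda>e. {x. \<sigma> * t \<le> e * (x - \<mu>)}"
  have "{x. \<sigma> * t \<le> \<bar>x - \<mu>\<bar>} = ?A 1 \<union> ?A (-1)" by auto
  then have "measure (gauss \<mu> \<sigma>) {x. \<sigma> * t \<le> \<bar>x - \<mu>\<bar>}
      \<le> measure (gauss \<mu> \<sigma>) (?A 1) + measure (gauss \<mu> \<sigma>) (?A (-1))"
    using measure_Un_le[of "?A 1" "gauss \<mu> \<sigma>" "?A (-1)"] by simp
  also have "\<dots> \<le> exp (- t\<^sup>2 / 2) + exp (- t\<^sup>2 / 2)"
    by (intro add_mono gauss_tail_one_sided \<sigma> t) auto
  finally show ?thesis by simp
qed

lemma gauss_central_moments:
  assumes \<sigma>: "0 < \<sigma>"
  shows "integrable (gauss \<mu> \<sigma>) (\<lambda>x. (x - \<mu>) ^ k)"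
    and "(\<integral>x. (x - \<mu>) \<partial>gauss \<mu> \<sigma>) = 0" "(\<integral>x. (x - \<mu>) ^ 2 \<partial>gauss \<mu> \<sigma>) = \<sigma>\<^sup>2"
    and "(\<integral>x. (x - \<mu>) ^ 3 \<partial>gauss \<mu> \<sigma>) = 0" "(\<integral>x. (x - \<mu>) ^ 4 \<partial>gauss \<mu> \<sigma>) = 3 * \<sigma> ^ 4"
proof -
  have I: "(\<integral>x. (x - \<mu>) ^ n \<partial>gauss \<mu> \<sigma>) = (\<integral>x. normal_density \<mu> \<sigma> x * (x - \<mu>) ^ n \<partial>lborel)" for n
    by (subst integral_density) (auto simp: normal_density_nonneg)
  show "integrable (gauss \<mu> \<sigma>) (\<lambda>x. (x - \<mu>) ^ k)"
    using integrable_normal_moment[OF \<sigma>, of \<mu> k]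
    by (subst integrable_density) (auto simp: normal_density_nonneg)
  show "(\<integral>x. (x - \<mu>) \<partial>gauss \<mu> \<sigma>) = 0"
    using integral_normal_moment_odd[OF \<sigma>, of \<mu> 0] I[of 1] by simp
  show "(\<integral>x. (x - \<mu>) ^ 2 \<partial>gauss \<mu> \<sigma>) = \<sigma>\<^sup>2"
    using integral_normal_moment_even[OF \<sigma>, of \<mu> 1] I[of 2] by simp
  show "(\<integral>x. (x - \<mu>) ^ 3 \<partial>gauss \<mu> \<sigma>) = 0"
    using integral_normal_moment_odd[OF \<sigma>, of \<mu> 1] I[of 3] by simp
  have "fact 4 / ((2 / \<sigma>\<^sup>2)\<^sup>2 * fact 2) = 3 * \<sigma> ^ 4"
    using \<sigma> by (simp add: fact_numeral field_simps flip: power_mult)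
  then show "(\<integral>x. (x - \<mu>) ^ 4 \<partial>gauss \<mu> \<sigma>) = 3 * \<sigma> ^ 4"
    using integral_normal_moment_even[OF \<sigma>, of \<mu> 2] I[of 4] by simp
qed

text \<open>Everything is expanded in powers of \<open>x - \<mu>\<close>. A mean
  \<open>\<mu>\<close> raises the expectation of the square by \<open>\<mu>\<^sup>2\<close> and its
  variance by \<open>4 * \<mu>\<^sup>2 * \<sigma>\<^sup>2\<close>, which is only linear in that
  gain; hence large signals do not spoil the dense test.\<close>

lemma gauss_square_moments:
  assumes \<sigma>: "0 < \<sigma>"
  shows "integrable (gauss \<mu> \<sigma>) (\<lambda>x. (x\<^sup>2)\<^sup>2)"
    and "(\<integral>x. x\<^sup>2 \<partial>gauss \<mu> \<sigma>) = \<mu>\<^sup>2 + \<sigma>\<^sup>2"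
    and "(\<integral>x. (x\<^sup>2 - (\<mu>\<^sup>2 + \<sigma>\<^sup>2))\<^sup>2 \<partial>gauss \<mu> \<sigma>) = 4 * \<mu>\<^sup>2 * \<sigma>\<^sup>2 + 2 * \<sigma> ^ 4"
proof -
  interpret P: prob_space "gauss \<mu> \<sigma>" by (rule prob_space_normal_density[OF \<sigma>])
  note m = gauss_central_moments(2-)[OF \<sigma>, of \<mu>]
  note i = gauss_central_moments(1)[OF \<sigma>, of \<mu>] gauss_central_moments(1)[OF \<sigma>, of \<mu> 1, simplified]
  have x4: "(x\<^sup>2)\<^sup>2 = (x - \<mu>) ^ 4 + 4 * \<mu> * (x - \<mu>) ^ 3 + 6 * \<mu>\<^sup>2 * (x - \<mu>)\<^sup>2 + 4 * \<mu> ^ 3 * (x - \<mu>) + \<mu> ^ 4" for x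
    by algebra
  have x2: "x\<^sup>2 = (x - \<mu>)\<^sup>2 + 2 * \<mu> * (x - \<mu>) + \<mu>\<^sup>2" for x
    by algebra
  have v: "(x\<^sup>2 - (\<mu>\<^sup>2 + \<sigma>\<^sup>2))\<^sup>2 = (x - \<mu>) ^ 4 + 4 * \<mu> * (x - \<mu>) ^ 3 + (4 * \<mu>\<^sup>2 - 2 * \<sigma>\<^sup>2) * (x - \<mu>)\<^sup>2
      + - 4 * \<mu> * \<sigma>\<^sup>2 * (x - \<mu>) + \<sigma> ^ 4" for x
    by algebra
  show "integrable (gauss \<mu> \<sigma>) (\<lambda>x. (x\<^sup>2)\<^sup>2)"
    unfolding x4 by (intro Bochner_Integration.integrable_add integrable_mult_right i) auto
  have "(\<integral>x. x\<^sup>2 \<partial>gauss \<mu> \<sigma>) = (\<integral>x. (x - \<mu>)\<^sup>2 + 2 * \<mu> * (x - \<mu>) + \<mu>\<^sup>2 \<partial>gauss \<mu> \<sigma>)"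
    by (rule Bochner_Integration.integral_cong[OF refl x2])
  also have "\<dots> = \<mu>\<^sup>2 + \<sigma>\<^sup>2"
    using i m P.prob_space by (simp del: space_density)
  finally show "(\<integral>x. x\<^sup>2 \<partial>gauss \<mu> \<sigma>) = \<mu>\<^sup>2 + \<sigma>\<^sup>2" .
  have "(\<integral>x. (x\<^sup>2 - (\<mu>\<^sup>2 + \<sigma>\<^sup>2))\<^sup>2 \<partial>gauss \<mu> \<sigma>) = 3 * \<sigma> ^ 4 + (4 * \<mu>\<^sup>2 - 2 * \<sigma>\<^sup>2) * \<sigma>\<^sup>2 + \<sigma> ^ 4"
    unfolding v using i m P.prob_space by (simp del: space_density)
  then show "(\<integral>x. (x\<^sup>2 - (\<mu>\<^sup>2 + \<sigma>\<^sup>2))\<^sup>2 \<partial>gauss \<mu> \<sigma>) = 4 * \<mu>\<^sup>2 * \<sigma>\<^sup>2 + 2 * \<sigma> ^ 4"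
    by (simp add: power2_eq_square power4_eq_xxxx algebra_simps)
qed

section \<open>The two families of alternatives\<close>

lemma Theta_nonempty:
  assumes "s \<le> d" "\<delta> \<noteq> 0"
  shows "Theta d s \<delta> \<noteq> {}"
proof -
  have "{j \<in> {1..d}. (\<lambda>j\<in>{1..d}. if j \<le> s then \<delta> else 0) j \<noteq> 0} = {1..s}"
    using assms by auto
  then have "(\<lambda>j\<in>{1..d}. if j \<le> s then \<delta> else 0) \<in> Theta d s \<delta>"
    by (simp add: Theta_def l0_norm_def)
  then show ?thesis by blast
qed

lemma l0_support_nonempty: "l0_norm d \<theta> = s \<Longrightarrow> 1 \<le> s \<Longrightarrow> {j \<in> {1..d}. \<theta> j \<noteq> 0} \<noteq> {}"
  unfolding l0_norm_def by (metis card.empty not_one_le_zero)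

lemma Theta_subset_Theta_star:
  assumes "1 \<le> s" "0 < \<delta>"
  shows "Theta d s \<delta> \<subseteq> Theta_star d s \<delta>"
proof
  fix \<theta> assume \<theta>: "\<theta> \<in> Theta d s \<delta>"
  then have "{j \<in> {1..d}. \<theta> j \<noteq> 0} \<noteq> {}"
    using l0_support_nonempty assms(1) unfolding Theta_def by blast
  moreover have "\<delta> \<le> \<bar>\<theta> j\<bar>" if "j \<in> {1..d}" "\<theta> j \<noteq> 0" for j
    using \<theta> that assms(2) by (force simp: Theta_def)
  ultimately have "\<delta> \<le> Min ((\<lambda>j. \<bar>\<theta> j\<bar>) ` {j \<in> {1..d}. \<theta> j \<noteq> 0})"
    by (subst Min_ge_iff) auto
  then show "\<theta> \<in> Theta_star d s \<delta>"
    using \<theta> by (simp add: Theta_def Theta_star_def)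
qed

lemma Theta_star_abs_ge:
  assumes "\<theta> \<in> Theta_star d s \<delta>" "j \<in> {1..d}" "\<theta> j \<noteq> 0"
  shows "\<delta> \<le> \<bar>\<theta> j\<bar>"
proof -
  have "Min ((\<lambda>j. \<bar>\<theta> j\<bar>) ` {j \<in> {1..d}. \<theta> j \<noteq> 0}) \<le> \<bar>\<theta> j\<bar>"
    using assms by (intro Min_le) auto
  then show ?thesis using assms(1) by (simp add: Theta_star_def)
qed

text \<open>The \<open>s\<close> nonzero coordinates give at least \<open>a\<close> each, the others
  give \<open>g 0 = 0\<close>. In the dense zone \<open>g\<close> is the square; in the sparse zone
  it is the excess of the exceedance probability over its null value.\<close>

lemma Theta_star_sum_ge:
  fixes g :: "real \<Rightarrow> real"
  assumes \<theta>: "\<theta> \<in> Theta_star d s \<delta>" and g: "g 0 = 0" "\<And>x. \<delta> \<le> \<bar>x\<bar> \<Longrightarrow> a \<le> g x"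
  shows "real s * a \<le> (\<Sum>j\<in>{1..d}. g (\<theta> j))"
proof -
  let ?J = "{j \<in> {1..d}. \<theta> j \<noteq> 0}"
  have "card ?J = s" using \<theta> by (simp add: Theta_star_def l0_norm_def)
  then have "real s * a = (\<Sum>j\<in>?J. a)" by simp
  also have "\<dots> \<le> (\<Sum>j\<in>?J. g (\<theta> j))"
    by (intro sum_mono g Theta_star_abs_ge[OF \<theta>]) auto
  also have "\<dots> = (\<Sum>j\<in>{1..d}. g (\<theta> j))"
    by (intro sum.mono_neutral_left) (auto simp: g)
  finally show ?thesis .
qed

section \<open>Upper bounds on the risk\<close>

text \<open>The mean of the sum of squares shifts by at least
  \<open>s * \<delta>\<^sup>2 = A\<^sup>2 * \<sigma>\<^sup>2 * sqrt d\<close>, while its null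
  standard deviation is \<open>\<sigma>\<^sup>2 * sqrt (2 * d)\<close>; the rate equates the two
  orders.\<close>

lemma minimax_risk_le_dense:
  assumes \<sigma>: "0 < \<sigma>" and s: "1 \<le> s" "s \<le> d" and \<epsilon>: "0 < \<epsilon>" "\<epsilon> < 1" and A: "7 / \<epsilon> < A"
  shows "minimax_risk d \<sigma> (Theta_star d s (A * (\<sigma> * real d powr (1 / 4) / sqrt (real s)))) \<le> \<epsilon>"
proof -
  define \<delta> where "\<delta> = A * (\<sigma> * real d powr (1 / 4) / sqrt (real s))"
  have "7 \<le> 7 / \<epsilon>" using \<epsilon> by (simp add: field_simps)
  then have A1: "1 < A" using A by linarith
  have "7 < A * \<epsilon>" using A \<epsilon> by (simp add: field_simps)
  \<comment> \<open>From \<open>A * \<epsilon> > 7\<close> the square exceeds 48, and one factor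
    \<open>\<epsilon> < 1\<close> is dropped. The constant is \<open>2 * (16 + 8)\<close>, where 16
    and 8 come from dividing the variance
    \<open>4 * r * \<sigma>\<^sup>2 + 2 * d * \<sigma> ^ 4\<close> by
    \<open>(r / 2)\<^sup>2\<close>.\<close>
  have A2: "48 \<le> \<epsilon> * A\<^sup>2"
  proof -
    have "7 * 7 \<le> (A * \<epsilon>) * (A * \<epsilon>)" using \<open>7 < A * \<epsilon>\<close> by (intro mult_mono) auto
    also have "\<dots> = \<epsilon> * (\<epsilon> * A\<^sup>2)" by (simp add: power2_eq_square)
    also have "\<dots> \<le> 1 * (\<epsilon> * A\<^sup>2)" using \<epsilon> by (intro mult_right_mono) auto
    finally show ?thesis by simp
  qed
  define q where "q = sqrt (real d)"
  have q1: "1 \<le> q" and q2: "q\<^sup>2 = real d" using s by (simp_all add: q_def)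
  have pq: "(real d powr (1 / 4))\<^sup>2 = q"
    using s by (simp add: q_def powr_half_sqrt[symmetric] power2_eq_square powr_add[symmetric])
  have \<delta>: "0 < \<delta>" using A1 \<sigma> s by (simp add: \<delta>_def)
  define w where "w = A\<^sup>2 * \<sigma>\<^sup>2 * q"
  have w: "0 < w" using A1 \<sigma> q1 by (simp add: w_def)
  have s\<delta>: "real s * \<delta>\<^sup>2 = w"
    using s by (simp add: \<delta>_def w_def power_mult_distrib power_divide pq)
  note sq = gauss_square_moments[OF \<sigma>]
  have A4: "24 / A\<^sup>2 \<le> \<epsilon> / 2" using A2 A1 by (simp add: field_simps)
  have A48: "8 / A ^ 4 \<le> 8 / A\<^sup>2" using A1 by (intro divide_left_mono power_increasing) auto
  have w2: "8 * real d * \<sigma> ^ 4 / w\<^sup>2 = 8 / A ^ 4"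
    using A1 \<sigma> q1 unfolding w_def q2[symmetric] by (simp add: field_simps)
  have w1: "16 * \<sigma>\<^sup>2 / w \<le> 16 / A\<^sup>2"
  proof -
    have "16 * \<sigma>\<^sup>2 / w = (16 / A\<^sup>2) / q" using A1 \<sigma> q1 unfolding w_def by (simp add: field_simps)
    also have "\<dots> \<le> (16 / A\<^sup>2) / 1" using q1 A1 by (intro divide_left_mono) auto
    finally show ?thesis by simp
  qed
  have "minimax_risk d \<sigma> (Theta_star d s \<delta>) \<le> \<epsilon>"
  proof (rule minimax_risk_le_sum_test[where \<phi> = "\<lambda>x. x\<^sup>2" and c\<^sub>0 = "w / 2", OF \<sigma>], unfold sq(2,3))
    show "Theta_star d s \<delta> \<noteq> {}"
      using Theta_nonempty[of s d \<delta>] Theta_subset_Theta_star[of s \<delta> d] s \<delta> by auto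
    show "integrable (gauss \<mu> \<sigma>) (\<lambda>x. (x\<^sup>2)\<^sup>2)" for \<mu> by (rule sq)
    show "0 < w / 2" using w by simp
    have "real d * (4 * 0\<^sup>2 * \<sigma>\<^sup>2 + 2 * \<sigma> ^ 4) / (w / 2)\<^sup>2 = 8 * real d * \<sigma> ^ 4 / w\<^sup>2"
      by (simp add: field_simps)
    also have "\<dots> \<le> 24 / A\<^sup>2"
      unfolding w2 using A48 by (rule order_trans) (intro divide_right_mono, auto)
    also note A4
    finally show "real d * (4 * 0\<^sup>2 * \<sigma>\<^sup>2 + 2 * \<sigma> ^ 4) / (w / 2)\<^sup>2 \<le> \<epsilon> / 2" .
    fix \<theta> assume \<theta>: "\<theta> \<in> Theta_star d s \<delta>"
    \<comment> \<open>The threshold margin \<open>w / 2\<close> is at most \<open>r / 2\<close>, so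
      \<open>r / 2\<close> remains as the margin \<open>c\<close>. Letting \<open>c\<close> scale
      with \<open>r\<close> makes the Chebyshev quotient decreasing in \<open>r\<close>, hence
      largest at \<open>r = w\<close>.\<close>
    define r where "r = (\<Sum>j\<in>{1..d}. (\<theta> j)\<^sup>2)"
    have "\<delta>\<^sup>2 \<le> x\<^sup>2" if "\<delta> \<le> \<bar>x\<bar>" for x using that \<delta> by (metis abs_le_square_iff abs_of_pos)
    then have r: "w \<le> r"
      using Theta_star_sum_ge[OF \<theta>, of "\<lambda>x. x\<^sup>2" "\<delta>\<^sup>2"] s\<delta> by (simp add: r_def)
    have "(\<Sum>j\<in>{1..d}. 4 * (\<theta> j)\<^sup>2 * \<sigma>\<^sup>2 + 2 * \<sigma> ^ 4) / (r / 2)\<^sup>2 = 16 * \<sigma>\<^sup>2 / r + 8 * real d * \<sigma> ^ 4 / r\<^sup>2"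
    proof -
      have "(\<Sum>j\<in>{1..d}. 4 * (\<theta> j)\<^sup>2 * \<sigma>\<^sup>2 + 2 * \<sigma> ^ 4) = 4 * r * \<sigma>\<^sup>2 + 2 * real d * \<sigma> ^ 4"
        by (simp add: r_def sum.distrib sum_distrib_left sum_distrib_right)
      then show ?thesis using r w by (simp add: field_simps power2_eq_square)
    qed
    also have "\<dots> \<le> 16 * \<sigma>\<^sup>2 / w + 8 * real d * \<sigma> ^ 4 / w\<^sup>2"
      using r w \<sigma> by (intro add_mono divide_left_mono power_mono mult_pos_pos zero_less_power) auto
    also have "\<dots> \<le> 16 / A\<^sup>2 + 8 / A\<^sup>2" using w1 w2 A48 by linarith
    also have "\<dots> \<le> \<epsilon> / 2" using A4 by (simp add: add_divide_distrib[symmetric])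
    finally have v: "(\<Sum>j\<in>{1..d}. 4 * (\<theta> j)\<^sup>2 * \<sigma>\<^sup>2 + 2 * \<sigma> ^ 4) / (r / 2)\<^sup>2 \<le> \<epsilon> / 2" .
    have "(\<Sum>j\<in>{1..d}. (\<theta> j)\<^sup>2 + \<sigma>\<^sup>2) = r + real d * \<sigma>\<^sup>2"
      by (simp add: r_def sum.distrib)
    then show "\<exists>c>0. real d * (0\<^sup>2 + \<sigma>\<^sup>2) + w / 2 + c \<le> (\<Sum>j\<in>{1..d}. (\<theta> j)\<^sup>2 + \<sigma>\<^sup>2) \<and>
        (\<Sum>j\<in>{1..d}. 4 * (\<theta> j)\<^sup>2 * \<sigma>\<^sup>2 + 2 * \<sigma> ^ 4) / c\<^sup>2 \<le> \<epsilon> / 2"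
      using v r w by (intro exI[of _ "r / 2"]) simp
  qed simp
  then show ?thesis by (simp add: \<delta>_def)
qed

text \<open>The statistic counts exceedances. The tail bound \<open>b = 2 / (1 + x) ^ K\<close>,
  with \<open>x = d / s\<^sup>2\<close>, bounds both the false alarm and the miss probability of a
  coordinate. The variance of the count is at most \<open>d * b\<close> under either hypothesis, and
  \<open>d * b / s\<^sup>2 = x * b\<close> is small for large \<open>K\<close>, uniformly in
  \<open>x \<ge> 1\<close>.\<close>

lemma minimax_risk_le_sparse:
  assumes \<sigma>: "0 < \<sigma>" and s: "1 \<le> s" "s \<le> d" "(real s)\<^sup>2 \<le> real d" and \<epsilon>: "0 < \<epsilon>" "\<epsilon> < 1"
    and K: "128 / 2 ^ K \<le> \<epsilon>" and A: "2 * sqrt (2 * real K) \<le> A"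
  shows "minimax_risk d \<sigma> (Theta_star d s (A * (\<sigma> * sqrt (ln (1 + real d / (real s)\<^sup>2))))) \<le> \<epsilon>"
proof -
  define x where "x = real d / (real s)\<^sup>2"
  have x: "1 \<le> x" using s by (simp add: x_def le_divide_eq)
  define l where "l = ln (1 + x)"
  have l: "0 < l" using x by (simp add: l_def)
  define \<delta> where "\<delta> = A * (\<sigma> * sqrt l)"
  define t where "t = sqrt (2 * real K * l)"
  have t0: "0 \<le> t" and t2: "t\<^sup>2 = 2 * real K * l" using l by (simp_all add: t_def)
  define b where "b = 2 / (1 + x) ^ K"
  have K0: "0 < K"
    using K \<epsilon> by (cases K) auto
  have A0: "0 < A" using A K0 by (smt (verit) of_nat_0_less_iff real_sqrt_gt_0_iff)
  have \<delta>0: "0 < \<delta>" using A0 \<sigma> l by (simp add: \<delta>_def)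
  have \<delta>t: "2 * (\<sigma> * t) \<le> \<delta>"
  proof -
    have "2 * (\<sigma> * t) = 2 * sqrt (2 * real K) * (\<sigma> * sqrt l)"
      by (simp add: t_def real_sqrt_mult)
    also have "\<dots> \<le> \<delta>" unfolding \<delta>_def using A \<sigma> l by (intro mult_right_mono) auto
    finally show ?thesis .
  qed
  have expb: "2 * exp (- t\<^sup>2 / 2) = b"
  proof -
    have "exp (- t\<^sup>2 / 2) = inverse (exp (real K * l))" by (simp add: t2 exp_minus)
    also have "exp (real K * l) = (1 + x) ^ K" using x by (simp add: exp_of_nat_mult l_def)
    finally show ?thesis by (simp add: b_def field_simps)
  qed
  \<comment> \<open>With \<open>b \<le> 1 / 4\<close> the exceedance probabilities of nonzero and
    zero coordinates differ by at least \<open>1 - 2 * b \<ge> 1 / 2\<close>. The resulting shift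
    \<open>s / 2\<close> is split into the two margins \<open>s / 4\<close>.\<close>
  have b4: "b \<le> 1 / 4"
  proof -
    have "2 ^ K \<le> (1 + x) ^ K" using x by (intro power_mono) auto
    then have "b \<le> 2 / 2 ^ K" unfolding b_def using x by (intro divide_left_mono) auto
    also have "\<dots> \<le> 1 / 4"
    proof -
      have "128 / 2 ^ K \<le> (1::real)" using K \<epsilon> by linarith
      then show ?thesis by (simp add: field_simps)
    qed
    finally show ?thesis .
  qed
  \<comment> \<open>One factor \<open>1 + x\<close> of the denominator of \<open>b\<close> absorbs
    \<open>x\<close>; the rest is bounded using \<open>1 + x \<ge> 2\<close>. This yields
    \<open>16 * x * b \<le> 64 / 2 ^ K\<close>, which explains the 128 in the assumption on
    \<open>K\<close>. The 16 comes from the margin \<open>s / 4\<close>.\<close>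
  have xb: "16 * x * b \<le> \<epsilon> / 2"
  proof -
    obtain n where n: "K = Suc n" using K0 by (cases K) auto
    have "x * b \<le> (1 + x) * b" using x by (intro mult_right_mono) (auto simp: b_def)
    also have "\<dots> = 2 / (1 + x) ^ n" using x by (simp add: b_def n divide_simps)
    also have "\<dots> \<le> 2 / 2 ^ n" using x by (intro divide_left_mono power_mono) auto
    also have "\<dots> = 128 / 2 ^ K / 32" by (simp add: n)
    also have "\<dots> \<le> \<epsilon> / 32" using K by (rule divide_right_mono) simp
    finally show ?thesis by simp
  qed
  let ?U = "{x::real. \<sigma> * t < \<bar>x\<bar>}"
  define \<phi> :: "real \<Rightarrow> real" where "\<phi> = indicator ?U"
  define p where "p \<mu> = measure (gauss \<mu> \<sigma>) ?U" for \<mu>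
  have U: "?U \<in> sets borel" by measurable
  have \<phi>m: "\<phi> \<in> borel_measurable borel" unfolding \<phi>_def using U by simp
  have \<phi>2: "(\<phi> x)\<^sup>2 = \<phi> x" for x by (simp add: \<phi>_def indicator_def)
  have E: "integrable (gauss \<mu> \<sigma>) \<phi>" "(\<integral>x. \<phi> x \<partial>gauss \<mu> \<sigma>) = p \<mu>" and p01: "0 \<le> p \<mu>" "p \<mu> \<le> 1" for \<mu>
  proof -
    interpret P: prob_space "gauss \<mu> \<sigma>" by (rule prob_space_normal_density[OF \<sigma>])
    show "integrable (gauss \<mu> \<sigma>) \<phi>"
      unfolding \<phi>_def using U by (intro integrable_real_indicator) (auto simp: P.emeasure_eq_measure)
    show "(\<integral>x. \<phi> x \<partial>gauss \<mu> \<sigma>) = p \<mu>"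
      using U by (simp add: \<phi>_def p_def)
    show "0 \<le> p \<mu>" "p \<mu> \<le> 1" by (simp_all add: p_def)
  qed
  have V: "(\<integral>x. (\<phi> x - p \<mu>)\<^sup>2 \<partial>gauss \<mu> \<sigma>) = p \<mu> * (1 - p \<mu>)" for \<mu>
  proof -
    interpret P: prob_space "gauss \<mu> \<sigma>" by (rule prob_space_normal_density[OF \<sigma>])
    show ?thesis
      using P.variance_eq[OF E(1)] E by (simp only: \<phi>2) (simp add: power2_eq_square right_diff_distrib)
  qed
  have p0: "p 0 \<le> b"
  proof -
    interpret P: prob_space "gauss 0 \<sigma>" by (rule prob_space_normal_density[OF \<sigma>])
    have "p 0 \<le> measure (gauss 0 \<sigma>) {x. \<sigma> * t \<le> \<bar>x - 0\<bar>}"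
      unfolding p_def by (intro P.finite_measure_mono) auto
    also have "\<dots> \<le> b" using gauss_tail[OF \<sigma> t0, of 0] expb by simp
    finally show ?thesis .
  qed
  have p\<mu>: "1 - b \<le> p \<mu>" if "\<delta> \<le> \<bar>\<mu>\<bar>" for \<mu>
  proof -
    interpret P: prob_space "gauss \<mu> \<sigma>" by (rule prob_space_normal_density[OF \<sigma>])
    have "1 - p \<mu> = measure (gauss \<mu> \<sigma>) (space (gauss \<mu> \<sigma>) - ?U)"
      unfolding p_def using U by (subst P.prob_compl) auto
    \<comment> \<open>A miss puts the observation within \<open>\<sigma> * t\<close> of 0, hence at
      distance at least \<open>\<sigma> * t\<close> from \<open>\<mu>\<close>, because
      \<open>\<bar>\<mu>\<bar>\<close> is at least \<open>2 * \<sigma> * t\<close>.\<close>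
    also have "\<dots> \<le> measure (gauss \<mu> \<sigma>) {x. \<sigma> * t \<le> \<bar>x - \<mu>\<bar>}"
      using that \<delta>t by (intro P.finite_measure_mono) auto
    also have "\<dots> \<le> b" using gauss_tail[OF \<sigma> t0, of \<mu>] expb by simp
    finally show ?thesis by simp
  qed
  have "minimax_risk d \<sigma> (Theta_star d s \<delta>) \<le> \<epsilon>"
  proof (rule minimax_risk_le_sum_test[where \<phi> = \<phi> and c\<^sub>0 = "real s / 4", OF \<sigma> _ \<phi>m], unfold E V \<phi>2)
    show "Theta_star d s \<delta> \<noteq> {}"
      using Theta_nonempty[of s d \<delta>] Theta_subset_Theta_star[of s \<delta> d] s \<delta>0 by auto
    show "integrable (gauss \<mu> \<sigma>) (\<lambda>x. \<phi> x)" for \<mu> using E(1) by simp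
    show "0 < real s / 4" using s by simp
    have db: "real d * b / (real s / 4)\<^sup>2 \<le> \<epsilon> / 2"
      using xb by (simp add: x_def field_simps)
    have v0: "p 0 * (1 - p 0) \<le> b"
      using mult_left_le[of "1 - p 0" "p 0"] p01[of 0] p0 by linarith
    have "real d * (p 0 * (1 - p 0)) / (real s / 4)\<^sup>2 \<le> real d * b / (real s / 4)\<^sup>2"
      using v0 by (intro divide_right_mono mult_left_mono) auto
    with db show "real d * (p 0 * (1 - p 0)) / (real s / 4)\<^sup>2 \<le> \<epsilon> / 2" by linarith
    fix \<theta> assume \<theta>: "\<theta> \<in> Theta_star d s \<delta>"
    \<comment> \<open>The Bernoulli variance is at most each of its two factors:
      \<open>p \<le> b\<close> serves the zero coordinates, \<open>1 - p \<le> b\<close> the nonzero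
      ones.\<close>
    have "p (\<theta> j) * (1 - p (\<theta> j)) \<le> b" if "j \<in> {1..d}" for j
    proof (cases "\<theta> j = 0")
      case False
      then show ?thesis
        using p\<mu>[OF Theta_star_abs_ge[OF \<theta> that]] p01[of "\<theta> j"]
          mult_left_le_one_le[of "1 - p (\<theta> j)" "p (\<theta> j)"] by linarith
    qed (use v0 in simp)
    then have "(\<Sum>j\<in>{1..d}. p (\<theta> j) * (1 - p (\<theta> j))) \<le> real d * b"
      using sum_bounded_above[of "{1..d}" "\<lambda>j. p (\<theta> j) * (1 - p (\<theta> j))" b] by simp
    then have "(\<Sum>j\<in>{1..d}. p (\<theta> j) * (1 - p (\<theta> j))) / (real s / 4)\<^sup>2 \<le> real d * b / (real s / 4)\<^sup>2"
      by (intro divide_right_mono) auto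
    then have v: "(\<Sum>j\<in>{1..d}. p (\<theta> j) * (1 - p (\<theta> j))) / (real s / 4)\<^sup>2 \<le> \<epsilon> / 2"
      using db by linarith
    have "real s * (1 / 2) \<le> (\<Sum>j\<in>{1..d}. p (\<theta> j) - p 0)"
    proof (rule Theta_star_sum_ge[OF \<theta>])
      show "1 / 2 \<le> p \<mu> - p 0" if "\<delta> \<le> \<bar>\<mu>\<bar>" for \<mu>
        using p\<mu>[OF that] p0 b4 by linarith
    qed simp
    then have "real d * p 0 + real s / 4 + real s / 4 \<le> (\<Sum>j\<in>{1..d}. p (\<theta> j))"
      by (simp add: sum_subtractf)
    then show "\<exists>c>0. real d * p 0 + real s / 4 + c \<le> (\<Sum>j\<in>{1..d}. p (\<theta> j)) \<and>
        (\<Sum>j\<in>{1..d}. p (\<theta> j) * (1 - p (\<theta> j))) / c\<^sup>2 \<le> \<epsilon> / 2"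
      using v s by (intro exI[of _ "real s / 4"]) simp
  qed
  then show ?thesis by (simp add: \<delta>_def l_def x_def)
qed

section \<open>Lower bounds on the risk\<close>

lemma exp_double_le: "0 \<le> y \<Longrightarrow> y \<le> 1 / 2 \<Longrightarrow> exp (2 * y) \<le> 1 + 4 * (y::real)"
  using exp_bound[of "2 * y"] mult_right_mono[of y "1 / 2" y] by (simp add: power2_eq_square)

text \<open>Here \<open>1 + \<kappa> = exp (A\<^sup>2 * l)\<close>, and convexity of the exponential
  between 0 and \<open>l = ln (1 + x)\<close> gives \<open>\<kappa> \<le> A\<^sup>2 * x\<close>.
  With \<open>x = d / s\<^sup>2\<close> the exponent of the spike bound is at most
  \<open>2 * A\<^sup>2\<close>, and \<open>A < \<epsilon> / 2\<close> turns
  \<open>1 + 4 * A\<^sup>2\<close> into at most \<open>1 + \<epsilon>\<^sup>2\<close>.\<close>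

lemma minimax_risk_ge_sparse:
  assumes \<sigma>: "0 < \<sigma>" and s: "1 \<le> s" "s \<le> d" and \<epsilon>: "0 < \<epsilon>" "\<epsilon> < 1" and A: "0 < A" "A < \<epsilon> / 2"
  shows "1 - \<epsilon> \<le> minimax_risk d \<sigma> (Theta d s (A * (\<sigma> * sqrt (ln (1 + real d / (real s)\<^sup>2)))))"
proof -
  define x where "x = real d / (real s)\<^sup>2"
  have x: "0 < x" using s by (simp add: x_def)
  define l where "l = ln (1 + x)"
  have l: "0 < l" "exp l = 1 + x" using x by (simp_all add: l_def)
  define \<delta> where "\<delta> = A * (\<sigma> * sqrt l)"
  have \<delta>: "0 < \<delta>" "\<delta>\<^sup>2 / \<sigma>\<^sup>2 = A\<^sup>2 * l" using A \<sigma> l by (simp_all add: \<delta>_def power_mult_distrib)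
  define \<kappa> where "\<kappa> = exp (A\<^sup>2 * l) - 1"
  have A2: "A\<^sup>2 \<le> \<epsilon>\<^sup>2 / 4" using power_mono[of A "\<epsilon> / 2" 2] A by (simp add: power_divide)
  have \<epsilon>2: "\<epsilon>\<^sup>2 \<le> 1" using \<epsilon> by (simp add: power_le_one)
  have \<kappa>0: "0 \<le> \<kappa>" using l by (simp add: \<kappa>_def)
  have \<kappa>: "\<kappa> \<le> A\<^sup>2 * x"
  proof -
    have "exp ((1 - A\<^sup>2) *\<^sub>R 0 + A\<^sup>2 *\<^sub>R l) \<le> (1 - A\<^sup>2) * exp 0 + A\<^sup>2 * exp l"
      by (rule convex_onD[OF exp_convex]) (use A2 \<epsilon>2 in auto)
    then show ?thesis by (simp add: \<kappa>_def l algebra_simps)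
  qed
  have "1 - \<epsilon> \<le> minimax_risk d \<sigma> (Theta d s \<delta>)"
  proof (rule minimax_risk_ge_spikes[OF \<sigma> \<epsilon>(1) s \<delta>(1), of "{1}"])
    show "spikes d s m \<delta> f \<in> Theta d s \<delta>"
      if "0 < m" "s * m \<le> d" "f \<in> {..<s} \<rightarrow>\<^sub>E {..<m} \<times> {1}" for m f
      by (rule spikes_in_Theta[OF that(1,2) \<delta>(1) _ that(3)]) auto
    show "(\<Sum>u\<in>{1}. \<Sum>v\<in>{1}. exp (\<delta>\<^sup>2 * u * v / \<sigma>\<^sup>2)) = (1 + \<kappa>) * (real (card {1::real}))\<^sup>2"
      by (simp add: \<kappa>_def \<delta>)
    have "2 * (real s)\<^sup>2 * \<kappa> / real d \<le> 2 * (real s)\<^sup>2 * (A\<^sup>2 * x) / real d"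
      using \<kappa> by (intro divide_right_mono mult_left_mono) auto
    also have "\<dots> = 2 * A\<^sup>2" using s by (simp add: x_def)
    finally have "exp (2 * (real s)\<^sup>2 * \<kappa> / real d) \<le> exp (2 * A\<^sup>2)" by simp
    also have "\<dots> \<le> 1 + 4 * A\<^sup>2" by (rule exp_double_le) (use A2 \<epsilon>2 in auto)
    finally show "exp (2 * (real s)\<^sup>2 * \<kappa> / real d) \<le> 1 + \<epsilon>\<^sup>2" using A2 by linarith
  qed (use \<kappa>0 in auto)
  then show ?thesis by (simp add: \<delta>_def l_def x_def)
qed

text \<open>Random signs make \<open>\<kappa> = cosh z - 1\<close> quadratic in
  \<open>z = A\<^sup>2 * sqrt d / s\<close>, so the factor \<open>s\<^sup>2 / d\<close> cancels and
  the exponent is at most \<open>2 * A ^ 4\<close>. With a constant sign \<open>\<kappa>\<close>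
  would be of order \<open>z\<close>, leaving the unbounded factor
  \<open>s / sqrt d\<close>.\<close>

lemma minimax_risk_ge_dense:
  assumes \<sigma>: "0 < \<sigma>" and s: "1 \<le> s" "s \<le> d" "sqrt (real d) \<le> real s"
    and \<epsilon>: "0 < \<epsilon>" "\<epsilon> < 1" and A: "0 < A" "A < \<epsilon> / 2"
  shows "1 - \<epsilon> \<le> minimax_risk d \<sigma> (Theta_star d s (A * (\<sigma> * real d powr (1 / 4) / sqrt (real s))))"
proof -
  define \<delta> where "\<delta> = A * (\<sigma> * real d powr (1 / 4) / sqrt (real s))"
  have pq: "(real d powr (1 / 4))\<^sup>2 = sqrt (real d)"
    using s by (simp add: powr_half_sqrt[symmetric] power2_eq_square powr_add[symmetric])
  define z where "z = A\<^sup>2 * sqrt (real d) / real s"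
  have \<delta>: "0 < \<delta>" "\<delta>\<^sup>2 / \<sigma>\<^sup>2 = z"
    using A \<sigma> s by (simp_all add: \<delta>_def z_def power_mult_distrib power_divide pq)
  have A2: "A\<^sup>2 \<le> \<epsilon>\<^sup>2 / 4" using power_mono[of A "\<epsilon> / 2" 2] A by (simp add: power_divide)
  have \<epsilon>2: "\<epsilon>\<^sup>2 \<le> 1" using \<epsilon> by (simp add: power_le_one)
  have z0: "0 < z" using A s by (simp add: z_def)
  \<comment> \<open>The dense condition enters here: it keeps \<open>z\<close> in the range where
    the quadratic bound on \<open>exp z\<close> holds.\<close>
  have zA: "z \<le> A\<^sup>2"
    using mult_left_mono[OF s(3), of "A\<^sup>2"] s by (simp add: z_def divide_le_eq)
  have z1: "z \<le> 1" using zA A2 \<epsilon>2 by linarith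
  define \<kappa> where "\<kappa> = (exp z + exp (- z)) / 2 - 1"
  have "2 \<le> exp z + exp (- z)"
    using exp_ge_add_one_self[of z] exp_ge_add_one_self[of "- z"] by linarith
  then have \<kappa>0: "0 \<le> \<kappa>" by (simp add: \<kappa>_def)
  \<comment> \<open>The linear terms of the bounds \<open>1 + z + z\<^sup>2\<close> and
    \<open>1 - z + z\<^sup>2\<close> cancel.\<close>
  have \<kappa>: "\<kappa> \<le> z\<^sup>2"
  proof -
    have "exp (- z) = 1 / exp z" by (simp add: exp_minus field_simps)
    also have "\<dots> \<le> 1 / (1 + z)" using z0 exp_ge_add_one_self[of z] by (intro divide_left_mono) auto
    also have "\<dots> \<le> 1 - z + z\<^sup>2"
    proof -
      have "(1 - z + z\<^sup>2) * (1 + z) = 1 + z ^ 3" by algebra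
      then show ?thesis using z0 by (simp add: divide_le_eq)
    qed
    finally have "exp (- z) \<le> 1 - z + z\<^sup>2" .
    moreover have "exp z \<le> 1 + z + z\<^sup>2" using exp_bound[of z] z0 z1 by simp
    ultimately have "exp z + exp (- z) \<le> 2 + 2 * z\<^sup>2" by linarith
    then show ?thesis by (simp add: \<kappa>_def field_simps)
  qed
  have "1 - \<epsilon> \<le> minimax_risk d \<sigma> (Theta_star d s \<delta>)"
  proof (rule minimax_risk_ge_spikes[OF \<sigma> \<epsilon>(1) s(1,2) \<delta>(1), of "{-1, 1}"])
    show "spikes d s m \<delta> f \<in> Theta_star d s \<delta>"
      if "0 < m" "s * m \<le> d" "f \<in> {..<s} \<rightarrow>\<^sub>E {..<m} \<times> {-1, 1}" for m f
      by (rule spikes_in_Theta_star[OF that(1,2) \<delta>(1) _ that(3) s(1)]) auto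
    \<comment> \<open>Of the four sign pairs two agree and two differ, so the mean is
      \<open>(exp z + exp (- z)) / 2\<close>.\<close>
    show "(\<Sum>u\<in>{-1, 1}. \<Sum>v\<in>{-1, 1}. exp (\<delta>\<^sup>2 * u * v / \<sigma>\<^sup>2)) = (1 + \<kappa>) * (real (card {-1, 1::real}))\<^sup>2"
      by (simp add: \<kappa>_def \<delta>)
    have "2 * (real s)\<^sup>2 * \<kappa> / real d \<le> 2 * (real s)\<^sup>2 * z\<^sup>2 / real d"
      using \<kappa> by (intro divide_right_mono mult_left_mono) auto
    also have "\<dots> = 2 * (A\<^sup>2 * A\<^sup>2)"
      using s by (simp add: z_def power_divide power_mult_distrib)
    also have "\<dots> \<le> 2 * (A\<^sup>2 * 1)"
      using A2 \<epsilon>2 by (intro mult_left_mono) auto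
    finally have "exp (2 * (real s)\<^sup>2 * \<kappa> / real d) \<le> exp (2 * A\<^sup>2)" by simp
    also have "\<dots> \<le> 1 + 4 * A\<^sup>2" by (rule exp_double_le) (use A2 \<epsilon>2 in auto)
    finally show "exp (2 * (real s)\<^sup>2 * \<kappa> / real d) \<le> 1 + \<epsilon>\<^sup>2" using A2 by linarith
  qed (use \<kappa>0 in auto)
  then show ?thesis by (simp add: \<delta>_def)
qed

section \<open>The two testing rates\<close>

theorem corollary2:
  "minimax_testing_rate
     {(d, s, \<sigma>). 1 \<le> s \<and> s \<le> d \<and> 0 < \<sigma> \<and> real s \<le> sqrt (real d)}
     Theta
     (\<lambda>d s \<sigma>. \<sigma> * sqrt (ln (1 + real d / (real s)\<^sup>2))) \<and>
   minimax_testing_rate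
     {(d, s, \<sigma>). 1 \<le> s \<and> s \<le> d \<and> 0 < \<sigma>}
     Theta_star
     (\<lambda>d s \<sigma>. if real s < sqrt (real d)
               then \<sigma> * sqrt (ln (1 + real d / (real s)\<^sup>2))
               else \<sigma> * real d powr (1 / 4) / sqrt (real s))"
proof -
  let ?l1 = "\<lambda>d s \<sigma>. \<sigma> * sqrt (ln (1 + real d / (real s)\<^sup>2))"
  let ?l2 = "\<lambda>d s \<sigma>. \<sigma> * real d powr (1 / 4) / sqrt (real s)"
  have l1: "0 < ?l1 d s \<sigma>" if "1 \<le> s" "s \<le> d" "0 < \<sigma>" for d s :: nat and \<sigma>
  proof -
    have "0 < real d / (real s)\<^sup>2" using that by simp
    then show ?thesis using that(3) by simp
  qed
  have l2: "0 < ?l2 d s \<sigma>" if "1 \<le> s" "s \<le> d" "0 < \<sigma>" for d s :: nat and \<sigma>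
    using that by simp
  have sq: "(real s)\<^sup>2 \<le> real d" if "real s \<le> sqrt (real d)" for d s :: nat
    using power_mono[OF that, of 2] by simp
  \<comment> \<open>Stated for \<open>Theta_star\<close> up to and including
    \<open>s = sqrt d\<close>: the claim on \<open>Theta\<close> contains that boundary, and its
    upper bound follows by inclusion.\<close>
  have up1: "\<exists>A\<^sub>0>0. \<forall>d s \<sigma> A. 1 \<le> s \<longrightarrow> s \<le> d \<longrightarrow> 0 < \<sigma> \<longrightarrow> real s \<le> sqrt (real d) \<longrightarrow> A\<^sub>0 < A \<longrightarrow>
      minimax_risk d \<sigma> (Theta_star d s (A * ?l1 d s \<sigma>)) \<le> \<epsilon>"
    if \<epsilon>: "0 < \<epsilon>" "\<epsilon> < 1" for \<epsilon> :: real
  proof -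
    obtain K where "(1 / 2) ^ K < \<epsilon> / 128" using real_arch_pow_inv[of "\<epsilon> / 128" "1 / 2"] \<epsilon> by auto
    then have K: "128 / 2 ^ K \<le> \<epsilon>" by (simp add: power_one_over field_simps)
    \<comment> \<open>The added 1 makes the constant visibly positive.\<close>
    have "0 < 1 + 2 * sqrt (2 * real K)" by (rule add_pos_nonneg) auto
    then show ?thesis
      using minimax_risk_le_sparse[OF _ _ _ sq \<epsilon> K]
      by (intro exI[of _ "1 + 2 * sqrt (2 * real K)"]) auto
  qed
  have lo1: "1 - \<epsilon> \<le> minimax_risk d \<sigma> (Theta_star d s (A * ?l1 d s \<sigma>))"
    if "1 \<le> s" "s \<le> d" "0 < \<sigma>" "0 < \<epsilon>" "\<epsilon> < 1" "0 < A" "A < \<epsilon> / 2" for d s :: nat and \<sigma> \<epsilon> A :: real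
  proof -
    have "0 < A * ?l1 d s \<sigma>" using l1[of s d \<sigma>] that by simp
    then have "minimax_risk d \<sigma> (Theta d s (A * ?l1 d s \<sigma>)) \<le> minimax_risk d \<sigma> (Theta_star d s (A * ?l1 d s \<sigma>))"
      using that by (intro minimax_risk_mono Theta_nonempty Theta_subset_Theta_star) auto
    with minimax_risk_ge_sparse[OF that(3,1,2,4-)] show ?thesis by (rule order_trans)
  qed
  have "minimax_testing_rate {(d, s, \<sigma>). 1 \<le> s \<and> s \<le> d \<and> 0 < \<sigma> \<and> real s \<le> sqrt (real d)} Theta ?l1"
    unfolding minimax_testing_rate_def
  proof (intro conjI allI impI)
    show "\<forall>(d, s, \<sigma>)\<in>{(d, s, \<sigma>). 1 \<le> s \<and> s \<le> d \<and> 0 < \<sigma> \<and> real s \<le> sqrt (real d)}. 0 < ?l1 d s \<sigma>"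
      using l1 by auto
    fix \<epsilon> :: real assume \<epsilon>: "0 < \<epsilon> \<and> \<epsilon> < 1"
    then obtain A\<^sub>0 where A\<^sub>0: "0 < A\<^sub>0" "\<And>d s \<sigma> A. 1 \<le> s \<Longrightarrow> s \<le> d \<Longrightarrow> 0 < \<sigma> \<Longrightarrow> real s \<le> sqrt (real d) \<Longrightarrow>
        A\<^sub>0 < A \<Longrightarrow> minimax_risk d \<sigma> (Theta_star d s (A * ?l1 d s \<sigma>)) \<le> \<epsilon>"
      using up1[of \<epsilon>] by blast
    have "minimax_risk d \<sigma> (Theta d s (A * ?l1 d s \<sigma>)) \<le> \<epsilon>"
      if "1 \<le> s" "s \<le> d" "0 < \<sigma>" "real s \<le> sqrt (real d)" "A\<^sub>0 < A" for d s \<sigma> A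
    proof -
      have "0 < A * ?l1 d s \<sigma>" using l1[of s d \<sigma>] that A\<^sub>0(1) by simp
      then have "minimax_risk d \<sigma> (Theta d s (A * ?l1 d s \<sigma>)) \<le> minimax_risk d \<sigma> (Theta_star d s (A * ?l1 d s \<sigma>))"
        using that by (intro minimax_risk_mono Theta_nonempty Theta_subset_Theta_star) auto
      then show ?thesis using A\<^sub>0(2)[OF that] by (rule order_trans)
    qed
    then show "\<exists>A\<^sub>0>0. \<forall>(d, s, \<sigma>)\<in>{(d, s, \<sigma>). 1 \<le> s \<and> s \<le> d \<and> 0 < \<sigma> \<and> real s \<le> sqrt (real d)}.
        \<forall>A>A\<^sub>0. minimax_risk d \<sigma> (Theta d s (A * ?l1 d s \<sigma>)) \<le> \<epsilon>"
      using A\<^sub>0(1) by (intro exI[of _ A\<^sub>0]) auto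
  next
    fix \<epsilon> :: real assume \<epsilon>: "0 < \<epsilon> \<and> \<epsilon> < 1"
    then show "\<exists>a\<^sub>0>0. \<forall>(d, s, \<sigma>)\<in>{(d, s, \<sigma>). 1 \<le> s \<and> s \<le> d \<and> 0 < \<sigma> \<and> real s \<le> sqrt (real d)}.
        \<forall>A. 0 < A \<and> A < a\<^sub>0 \<longrightarrow> 1 - \<epsilon> \<le> minimax_risk d \<sigma> (Theta d s (A * ?l1 d s \<sigma>))"
      using minimax_risk_ge_sparse by (intro exI[of _ "\<epsilon> / 2"]) auto
  qed
  moreover have "minimax_testing_rate {(d, s, \<sigma>). 1 \<le> s \<and> s \<le> d \<and> 0 < \<sigma>} Theta_star
      (\<lambda>d s \<sigma>. if real s < sqrt (real d) then ?l1 d s \<sigma> else ?l2 d s \<sigma>)"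
    unfolding minimax_testing_rate_def
  proof (intro conjI allI impI)
    show "\<forall>(d, s, \<sigma>)\<in>{(d, s, \<sigma>). 1 \<le> s \<and> s \<le> d \<and> 0 < \<sigma>}.
        0 < (if real s < sqrt (real d) then ?l1 d s \<sigma> else ?l2 d s \<sigma>)"
      using l1 l2 by auto
    fix \<epsilon> :: real assume \<epsilon>: "0 < \<epsilon> \<and> \<epsilon> < 1"
    then obtain A\<^sub>0 where A\<^sub>0: "0 < A\<^sub>0" "\<And>d s \<sigma> A. 1 \<le> s \<Longrightarrow> s \<le> d \<Longrightarrow> 0 < \<sigma> \<Longrightarrow> real s \<le> sqrt (real d) \<Longrightarrow>
        A\<^sub>0 < A \<Longrightarrow> minimax_risk d \<sigma> (Theta_star d s (A * ?l1 d s \<sigma>)) \<le> \<epsilon>"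
      using up1[of \<epsilon>] by blast
    \<comment> \<open>The maximum of the sparse and dense constants serves both zones, so the
      constant depends on \<open>\<epsilon>\<close> only.\<close>
    have "minimax_risk d \<sigma> (Theta_star d s (A * (if real s < sqrt (real d) then ?l1 d s \<sigma> else ?l2 d s \<sigma>))) \<le> \<epsilon>"
      if "1 \<le> s" "s \<le> d" "0 < \<sigma>" "max A\<^sub>0 (7 / \<epsilon>) < A" for d s \<sigma> A
      using A\<^sub>0(2)[of s d \<sigma> A] minimax_risk_le_dense[of \<sigma> s d \<epsilon> A] \<epsilon> that by auto
    then show "\<exists>A\<^sub>0>0. \<forall>(d, s, \<sigma>)\<in>{(d, s, \<sigma>). 1 \<le> s \<and> s \<le> d \<and> 0 < \<sigma>}.
        \<forall>A>A\<^sub>0. minimax_risk d \<sigma> (Theta_star d s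
          (A * (if real s < sqrt (real d) then ?l1 d s \<sigma> else ?l2 d s \<sigma>))) \<le> \<epsilon>"
      using A\<^sub>0(1) by (intro exI[of _ "max A\<^sub>0 (7 / \<epsilon>)"]) (auto simp: less_max_iff_disj)
  next
    fix \<epsilon> :: real assume \<epsilon>: "0 < \<epsilon> \<and> \<epsilon> < 1"
    have "1 - \<epsilon> \<le> minimax_risk d \<sigma> (Theta_star d s
        (A * (if real s < sqrt (real d) then ?l1 d s \<sigma> else ?l2 d s \<sigma>)))"
      if "1 \<le> s" "s \<le> d" "0 < \<sigma>" "0 < A" "A < \<epsilon> / 2" for d s \<sigma> A
      using lo1[of s d \<sigma> \<epsilon> A] minimax_risk_ge_dense[of \<sigma> s d \<epsilon> A] \<epsilon> that by auto
    then show "\<exists>a\<^sub>0>0. \<forall>(d, s, \<sigma>)\<in>{(d, s, \<sigma>). 1 \<le> s \<and> s \<le> d \<and> 0 < \<sigma>}.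
        \<forall>A. 0 < A \<and> A < a\<^sub>0 \<longrightarrow> 1 - \<epsilon> \<le> minimax_risk d \<sigma> (Theta_star d s
          (A * (if real s < sqrt (real d) then ?l1 d s \<sigma> else ?l2 d s \<sigma>)))"
      using \<epsilon> by (intro exI[of _ "\<epsilon> / 2"]) auto
  qed
  ultimately show ?thesis by blast
qed

end
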